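(* The singular locus of $\hat{G}_2$ is a plane.
   Context: We work over $\mathbb{C}$. Let $V$ be a 7-dimensional vector space with basis $x_1,\dots,x_7$ and $\omega_0= x_1\wedge x_2 \wedge x_3 \wedge x_7+x_4\wedge x_5 \wedge x_6 \wedge x_7 + x_2\wedge x_3 \wedge x_5 \wedge x_6 + x_1\wedge x_3 \wedge x_4 \wedge x_6\in\bigwedge^4V$. Then $\hat{G}_2=\{[v_1\wedge v_2]\in G(2,V) : v_1\wedge v_2\wedge\omega_0=0\in\bigwedge^6V\}\subset\mathbb{P}(\bigwedge^2V)$. Here "plane" means a linearly embedded $\mathbb{P}^2$ in $\mathbb{P}(\bigwedge^2V)$. *)

theory Defs
  imports "HOL-Analysis.Analysis" "HOL-Library.Extended_Nat"
begin

subsection \<open>The exterior algebra of a coordinate space\<close>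

text \<open>The exterior algebra of \<open>\<complex>\<^sup>n\<close> is modelled on its standard basis \<open>e\<^sub>S = e\<^sub>i \<and> e\<^sub>j \<and> \<dots>\<close>
  (\<open>i < j < \<dots>\<close> the elements of \<open>S\<close>), with \<open>S\<close> ranging over the subsets of the index type, so
  that \<open>e\<^sub>A \<and> e\<^sub>B\<close> is \<open>0\<close> if \<open>A\<close> and \<open>B\<close> meet, and otherwise \<open>e\<^bsub>A \<union> B\<^esub>\<close> times the sign of the
  permutation that sorts \<open>A\<close> followed by \<open>B\<close>.\<close>

type_synonym 'n ext = "complex ^ ('n set)"

definition shuffle_sign :: "'n::linorder set \<Rightarrow> 'n set \<Rightarrow> complex" where
  "shuffle_sign A B = (-1) ^ card {(a, b). a \<in> A \<and> b \<in> B \<and> b < a}"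

definition wedge :: "'n::{finite, linorder} ext \<Rightarrow> 'n ext \<Rightarrow> 'n ext" (infixr "\<and>\<^sub>E" 70) where
  "\<alpha> \<and>\<^sub>E \<beta> = (\<chi> S. \<Sum>A\<in>Pow S. shuffle_sign A (S - A) * \<alpha> $ A * \<beta> $ (S - A))"

definition ext_power :: "nat \<Rightarrow> 'n::finite ext set" where
  "ext_power k = {\<alpha>. \<forall>S. card S \<noteq> k \<longrightarrow> \<alpha> $ S = 0}"

definition ext_of_vec :: "complex ^ 'n::finite \<Rightarrow> 'n ext" where
  "ext_of_vec v = (\<Sum>i\<in>UNIV. v $ i *s axis {i} 1)"


subsection \<open>Projective varieties, tangent spaces and singular points\<close>

text \<open>Points of a projective space \<open>\<P>(W)\<close> are the lines through the origin in \<open>W\<close>.\<close>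

definition proj_space :: "(complex ^ 'm::finite) set \<Rightarrow> (complex ^ 'm) set set" where
  "proj_space W = {L. vec.subspace L \<and> vec.dim L = 1 \<and> L \<subseteq> W}"

definition hom_poly :: "nat \<Rightarrow> (complex ^ 'm::finite \<Rightarrow> complex) \<Rightarrow> bool" where
  "hom_poly d f \<longleftrightarrow> (\<exists>M c. finite M \<and> (\<forall>m\<in>M. (\<Sum>i\<in>UNIV. m i) = d) \<and>
     f = (\<lambda>x. \<Sum>m\<in>M. c m * (\<Prod>i\<in>UNIV. (x $ i) ^ m i)))"

definition vanishes_on :: "(complex ^ 'm::finite \<Rightarrow> complex) \<Rightarrow> (complex ^ 'm) set set \<Rightarrow> bool" where
  "vanishes_on f X \<longleftrightarrow> (\<forall>L\<in>X. \<forall>w\<in>L. f w = 0)"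

definition zariski_closed :: "(complex ^ 'm::finite) set set \<Rightarrow> bool" where
  "zariski_closed Z \<longleftrightarrow> (\<exists>F. (\<forall>f\<in>F. \<exists>d. hom_poly d f) \<and>
     Z = {L \<in> proj_space UNIV. \<forall>f\<in>F. vanishes_on f {L}})"

definition irreducible_closed :: "(complex ^ 'm::finite) set set \<Rightarrow> bool" where
  "irreducible_closed Z \<longleftrightarrow> zariski_closed Z \<and> Z \<noteq> {} \<and>
     (\<forall>A B. zariski_closed A \<and> zariski_closed B \<and> Z = A \<union> B \<longrightarrow> A = Z \<or> B = Z)"

text \<open>The Krull dimension of the local ring of \<open>X\<close> at \<open>L\<close>: chains of prime ideals of that ring
  correspond to chains of irreducible closed subsets of \<open>X\<close> passing through \<open>L\<close>.\<close>

definition local_dim :: "(complex ^ 'm::finite) set set \<Rightarrow> (complex ^ 'm) set \<Rightarrow> enat" where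
  "local_dim X L = Sup {enat n | n. \<exists>Z :: nat \<Rightarrow> (complex ^ 'm) set set.
     (\<forall>i\<le>n. irreducible_closed (Z i) \<and> L \<in> Z i \<and> Z i \<subseteq> X) \<and> (\<forall>i<n. Z i \<subset> Z (Suc i))}"

text \<open>The linear subspace whose projectivisation is the projective tangent space of \<open>X\<close> at \<open>L\<close>,
  i.e. the tangent space of the affine cone over \<open>X\<close> at a nonzero point of \<open>L\<close>: the common kernel
  of the differentials of all forms in the full homogeneous ideal of \<open>X\<close>. Its dimension is one
  more than that of the Zariski tangent space of \<open>X\<close> at \<open>L\<close>.\<close>

definition cone_tangent_space ::
    "(complex ^ 'm::finite) set set \<Rightarrow> (complex ^ 'm) set \<Rightarrow> (complex ^ 'm) set" where
  "cone_tangent_space X L = {u. \<forall>d f. hom_poly d f \<and> vanishes_on f X \<longrightarrow>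
     (\<forall>w\<in>L - {0}. ((\<lambda>t. f (w + t *s u)) has_field_derivative 0) (at 0))}"

definition singular_locus :: "(complex ^ 'm::finite) set set \<Rightarrow> (complex ^ 'm) set set" where
  "singular_locus X = {L \<in> X. enat (vec.dim (cone_tangent_space X L)) > local_dim X L + 1}"

definition plane_in :: "(complex ^ 'm::finite) set \<Rightarrow> (complex ^ 'm) set set \<Rightarrow> bool" where
  "plane_in E P \<longleftrightarrow> (\<exists>W. vec.subspace W \<and> W \<subseteq> E \<and> vec.dim W = 3 \<and> P = proj_space W)"


subsection \<open>The variety\<close>

text \<open>\<open>V\<close> is \<open>\<complex>\<^sup>7\<close> with its standard basis, indexed by the seven-element type \<open>7\<close>. In that type the
  numeral \<open>7\<close> equals \<open>0\<close>, hence is the least index; this only affects which of \<open>\<plusminus>e\<^sub>S\<close> is taken as a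
  coordinate.\<close>

definition xv :: "7 \<Rightarrow> 7 ext" where
  "xv i = ext_of_vec (axis i 1)"

definition \<omega>\<^sub>0 :: "7 ext" where
  "\<omega>\<^sub>0 = (xv 1 \<and>\<^sub>E xv 2 \<and>\<^sub>E xv 3 \<and>\<^sub>E xv 7) + (xv 4 \<and>\<^sub>E xv 5 \<and>\<^sub>E xv 6 \<and>\<^sub>E xv 7)
      + (xv 2 \<and>\<^sub>E xv 3 \<and>\<^sub>E xv 5 \<and>\<^sub>E xv 6) + (xv 1 \<and>\<^sub>E xv 3 \<and>\<^sub>E xv 4 \<and>\<^sub>E xv 6)"

text \<open>The Grassmannian \<open>G(2,V)\<close> in its Pluecker embedding into \<open>\<P>(\<And>\<^sup>2V)\<close>; the condition
  \<open>L \<in> proj_space _\<close> forces \<open>v\<^sub>1 \<and> v\<^sub>2 \<noteq> 0\<close>.\<close>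

definition G2V :: "7 ext set set" where
  "G2V = {L \<in> proj_space (ext_power 2). \<exists>v\<^sub>1 v\<^sub>2. L = vec.span {ext_of_vec v\<^sub>1 \<and>\<^sub>E ext_of_vec v\<^sub>2}}"

definition G2_hat :: "7 ext set set" where
  "G2_hat = {L \<in> G2V. \<exists>v\<^sub>1 v\<^sub>2. L = vec.span {ext_of_vec v\<^sub>1 \<and>\<^sub>E ext_of_vec v\<^sub>2} \<and>
     ext_of_vec v\<^sub>1 \<and>\<^sub>E ext_of_vec v\<^sub>2 \<and>\<^sub>E \<omega>\<^sub>0 = 0}"

end

theory Submission
  imports Defs
begin

text \<open>Write \<open>p\<^sub>i\<^sub>j\<close> for the Pluecker coordinates of \<open>v \<and> v'\<close>. The condition
  \<open>v \<and> v' \<and> \<omega>\<^sub>0 = 0\<close> amounts to seven linear equations in the \<open>p\<^sub>i\<^sub>j\<close>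
  (\<open>wedge_omega0_eq_0_iff\<close>), whose meaning is visible after a change of viewpoint. Let \<open>A\<close> and
  \<open>B\<close> be planes; up to signs, \<open>x\<^sub>1, x\<^sub>2, x\<^sub>4, x\<^sub>5\<close> is the basis of \<open>A \<otimes> B\<close> in which \<open>x\<^sub>1, x\<^sub>5\<close>
  span \<open>A \<otimes> b\<^sub>1\<close> and \<open>x\<^sub>2, x\<^sub>4\<close> span \<open>A \<otimes> b\<^sub>2\<close>, while \<open>x\<^sub>3, x\<^sub>6, x\<^sub>7\<close> is a basis of the space
  \<open>S\<^sup>2A\<^sup>*\<close> of symmetric matrices. For \<open>v = (u, s)\<close> and \<open>v' = (u', s')\<close> in \<open>V = (A \<otimes> B) \<oplus> S\<^sup>2A\<^sup>*\<close> the
  equations say that \<open>s u' = s' u\<close> and that \<open>u \<and> u'\<close> has no component in \<open>S\<^sup>2A \<otimes> \<And>\<^sup>2B\<close>. If \<open>u\<close> and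
  \<open>u'\<close> are linearly independent, then they span \<open>A \<otimes> b\<close> for some \<open>b\<close>, and \<open>s, s'\<close> are the
  contractions of one binary cubic \<open>C\<close>. This gives a five-dimensional family of points, indexed by
  the pairs \<open>(b, C)\<close> up to scaling. At the other extreme, \<open>u = u' = 0\<close> gives the points of the plane
  \<open>\<P>(\<And>\<^sup>2S\<^sup>2A\<^sup>*)\<close>, spanned by \<open>x\<^sub>3 \<and> x\<^sub>6\<close>, \<open>x\<^sub>3 \<and> x\<^sub>7\<close> and \<open>x\<^sub>6 \<and> x\<^sub>7\<close>. This plane is the singular locus.\<close>

text \<open>\<^emph>\<open>Smoothness outside the plane.\<close> At a point outside the plane one of the coordinates
  \<open>p\<^sub>1\<^sub>5, p\<^sub>2\<^sub>4, p\<^sub>1\<^sub>6, p\<^sub>2\<^sub>6, p\<^sub>3\<^sub>5, p\<^sub>3\<^sub>4\<close> is nonzero (\<open>outside_charts\<close>), and the part of the variety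
  where one of them is nonzero is the graph of a polynomial map on \<open>\<complex>\<^sup>5\<close> (\<open>chart_A\<close>, \<open>chart_B\<close>; signed
  permutations of the basis exchanging the vectors of \<open>A\<close> or those of \<open>B\<close> reduce the six cases to
  two). The closures of the images of a flag of affine subspaces of \<open>\<complex>\<^sup>5\<close> form a chain of length five
  of irreducible closed sets, so the local dimension is at least 5, and the differentials of the
  defining equations bound the dimension of the tangent space of the cone by 6.\<close>

text \<open>\<^emph>\<open>Singularity along the plane.\<close> The quadratic map \<open>\<phi>\<close> that sends \<open>(b, C) \<in> \<complex>\<^sup>6\<close> to the
  bivector described above has dense image (\<open>\<phi>_dense\<close>). Forms of degree \<open>d\<close> on the variety are thus
  determined by forms of degree \<open>2 d\<close> in six variables, and the space of these grows like \<open>d\<^sup>5\<close>. A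
  chain of length \<open>n\<close> of irreducible closed sets, however, provides \<open>n + d choose n\<close> linearly
  independent forms of degree proportional to \<open>d\<close> (\<open>many_independent_forms\<close>). Hence the local dimension
  is at most 5. The tangent space at a point \<open>w\<close> of the plane contains the cone over the plane and,
  whenever \<open>\<phi>(0, C)\<close> equals \<open>w\<close>, the derivatives at \<open>t = 0\<close> of the curves \<open>\<phi>(t b, C)\<close> for all \<open>b \<in> B\<close>. The
  equation \<open>\<phi>(0, C) = w\<close> prescribes the Hessian of the binary cubic \<open>C\<close> and always has two linearly
  independent solutions (\<open>hankel_minors\<close>). So the tangent space has dimension at least
  \<open>3 + 2 + 2 = 7\<close>, which exceeds \<open>5 + 1\<close>.\<close>

section \<open>Homogeneous polynomials\<close>

lemma hom_poly_zero: "hom_poly d (\<lambda>_. 0)"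
  unfolding hom_poly_def by (rule exI[of _ "{}"]) auto

lemma hom_poly_monomial:
  assumes "(\<Sum>i\<in>UNIV. m i) = d"
  shows "hom_poly d (\<lambda>x::complex^'m::finite. c * (\<Prod>i\<in>UNIV. (x $ i) ^ m i))"
  unfolding hom_poly_def using assms
  by (intro exI[of _ "{m}"] exI[of _ "\<lambda>_. c"]) auto

lemma hom_poly_add:
  assumes "hom_poly d f" "hom_poly d g"
  shows "hom_poly d (\<lambda>x. f x + g x)"
proof -
  obtain M c where M: "finite M" "\<forall>m\<in>M. (\<Sum>i\<in>UNIV. m i) = d"
    "f = (\<lambda>x. \<Sum>m\<in>M. c m * (\<Prod>i\<in>UNIV. (x $ i) ^ m i))"
    using assms(1) unfolding hom_poly_def by blast
  obtain N e where N: "finite N" "\<forall>m\<in>N. (\<Sum>i\<in>UNIV. m i) = d"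
    "g = (\<lambda>x. \<Sum>m\<in>N. e m * (\<Prod>i\<in>UNIV. (x $ i) ^ m i))"
    using assms(2) unfolding hom_poly_def by blast
  define k where "k m = (if m \<in> M then c m else 0) + (if m \<in> N then e m else 0)" for m
  have 1: "f x = (\<Sum>m\<in>M \<union> N. (if m \<in> M then c m else 0) * (\<Prod>i\<in>UNIV. (x $ i) ^ m i))" for x
    unfolding M(3) by (rule sum.mono_neutral_cong_left) (use M N in auto)
  have 2: "g x = (\<Sum>m\<in>M \<union> N. (if m \<in> N then e m else 0) * (\<Prod>i\<in>UNIV. (x $ i) ^ m i))" for x
    unfolding N(3) by (rule sum.mono_neutral_cong_left) (use M N in auto)
  have "(\<lambda>x. f x + g x) = (\<lambda>x. \<Sum>m\<in>M \<union> N. k m * (\<Prod>i\<in>UNIV. (x $ i) ^ m i))"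
    unfolding 1 2 k_def by (simp add: sum.distrib distrib_right)
  then show ?thesis
    unfolding hom_poly_def using M(1,2) N(1,2) by (intro exI[of _ "M \<union> N"] exI[of _ k]) auto
qed

lemma hom_poly_sum:
  "(\<And>a. a \<in> A \<Longrightarrow> hom_poly d (f a)) \<Longrightarrow> hom_poly d (\<lambda>x. \<Sum>a\<in>A. f a x)"
  by (induction A rule: infinite_finite_induct) (auto intro: hom_poly_add hom_poly_zero)

lemma hom_poly_mult:
  assumes "hom_poly d f" "hom_poly e g"
  shows "hom_poly (d + e) (\<lambda>x. f x * g x)"
proof -
  obtain M c where M: "finite M" "\<forall>m\<in>M. (\<Sum>i\<in>UNIV. m i) = d"
    "f = (\<lambda>x. \<Sum>m\<in>M. c m * (\<Prod>i\<in>UNIV. (x $ i) ^ m i))"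
    using assms(1) unfolding hom_poly_def by blast
  obtain N b where N: "finite N" "\<forall>m\<in>N. (\<Sum>i\<in>UNIV. m i) = e"
    "g = (\<lambda>x. \<Sum>m\<in>N. b m * (\<Prod>i\<in>UNIV. (x $ i) ^ m i))"
    using assms(2) unfolding hom_poly_def by blast
  have "(\<lambda>x. f x * g x) =
    (\<lambda>x. \<Sum>m\<in>M. \<Sum>n\<in>N. (c m * b n) * (\<Prod>i\<in>UNIV. (x $ i) ^ (m i + n i)))"
    unfolding M(3) N(3) sum_product by (simp add: power_add prod.distrib ac_simps)
  then show ?thesis
    using M N by (auto intro!: hom_poly_sum hom_poly_monomial simp: sum.distrib)
qed

lemma hom_poly_const: "hom_poly 0 (\<lambda>_. c)"
  using hom_poly_monomial[of "\<lambda>_. 0" 0 c] by simp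

lemma hom_poly_cmult: "hom_poly d f \<Longrightarrow> hom_poly d (\<lambda>x. c * f x)"
  using hom_poly_mult[OF hom_poly_const] by fastforce

lemma hom_poly_diff: "hom_poly d f \<Longrightarrow> hom_poly d g \<Longrightarrow> hom_poly d (\<lambda>x. f x - g x)"
  using hom_poly_add[OF _ hom_poly_cmult[of d g "-1"], of f] by simp

lemma hom_poly_coord: "hom_poly 1 (\<lambda>x. x $ i)"
proof -
  have "(\<lambda>x::complex^'a. x $ i) = (\<lambda>x. 1 * (\<Prod>j\<in>UNIV. (x $ j) ^ (if j = i then 1 else 0)))"
  proof
    fix x :: "complex^'a"
    have "(\<Prod>j\<in>UNIV. (x $ j) ^ (if j = i then 1 else 0)) = (\<Prod>j\<in>UNIV. if j = i then x $ j else 1)"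
      by (rule prod.cong) auto
    then show "x $ i = 1 * (\<Prod>j\<in>UNIV. (x $ j) ^ (if j = i then 1 else 0))" by simp
  qed
  then show ?thesis by (simp only: hom_poly_monomial[of "\<lambda>j. if j = i then 1 else 0" 1] sum.delta) (rule hom_poly_monomial, simp)
qed

lemma hom_poly_power: "hom_poly d f \<Longrightarrow> hom_poly (k * d) (\<lambda>x. f x ^ k)"
  by (induction k) (auto intro: hom_poly_mult hom_poly_const)

lemma hom_poly_prod:
  "finite A \<Longrightarrow> (\<And>a. a \<in> A \<Longrightarrow> hom_poly (d a) (f a)) \<Longrightarrow> hom_poly (\<Sum>a\<in>A. d a) (\<lambda>x. \<Prod>a\<in>A. f a x)"
  by (induction A rule: finite_induct) (auto intro: hom_poly_mult hom_poly_const)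

lemma hom_poly_compose:
  assumes "hom_poly d f" "\<And>i. hom_poly e (\<lambda>x. \<phi> x $ i)"
  shows "hom_poly (d * e) (\<lambda>x. f (\<phi> x))"
proof -
  obtain M c where M: "finite M" "\<forall>m\<in>M. (\<Sum>i\<in>UNIV. m i) = d"
    "f = (\<lambda>x. \<Sum>m\<in>M. c m * (\<Prod>i\<in>UNIV. (x $ i) ^ m i))"
    using assms(1) unfolding hom_poly_def by blast
  have "hom_poly (d * e) (\<lambda>x. c m * (\<Prod>i\<in>UNIV. (\<phi> x $ i) ^ m i))" if "m \<in> M" for m
  proof -
    have "hom_poly (\<Sum>i\<in>UNIV. m i * e) (\<lambda>x. \<Prod>i\<in>UNIV. (\<phi> x $ i) ^ m i)"
      by (rule hom_poly_prod) (auto intro: hom_poly_power assms)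
    moreover have "(\<Sum>i\<in>UNIV. m i * e) = d * e"
      using M(2) that by (simp flip: sum_distrib_right)
    ultimately show ?thesis by (simp add: hom_poly_cmult)
  qed
  then show ?thesis unfolding M(3) by (rule hom_poly_sum)
qed

lemma hom_poly_scale:
  assumes "hom_poly d f"
  shows "f (a *s x) = a ^ d * f x"
proof -
  obtain M c where M: "finite M" "\<forall>m\<in>M. (\<Sum>i\<in>UNIV. m i) = d"
    "f = (\<lambda>x. \<Sum>m\<in>M. c m * (\<Prod>i\<in>UNIV. (x $ i) ^ m i))"
    using assms(1) unfolding hom_poly_def by blast
  have "(\<Prod>i\<in>UNIV. ((a *s x) $ i) ^ m i) = a ^ d * (\<Prod>i\<in>UNIV. (x $ i) ^ m i)" if "m \<in> M" for m
    using M(2) that by (auto simp: power_mult_distrib prod.distrib power_sum)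
  then show ?thesis unfolding M(3) by (simp add: sum_distrib_left mult_ac cong: sum.cong)
qed

text \<open>A form is a finite sum of products of constants and coordinates. Properties that are stable under sums and products therefore hold for all forms once they hold for these.\<close>

lemma hom_poly_induct:
  assumes "hom_poly d f"
    and const: "\<And>c. P (\<lambda>_. c)" and coord: "\<And>i. P (\<lambda>x. x $ i)"
    and add: "\<And>f g. P f \<Longrightarrow> P g \<Longrightarrow> P (\<lambda>x. f x + g x)"
    and mult: "\<And>f g. P f \<Longrightarrow> P g \<Longrightarrow> P (\<lambda>x. f x * g x)"
  shows "P f"
proof -
  have power: "P (\<lambda>x. g x ^ k)" if "P g" for g k
    using that by (induction k) (auto intro: const mult)
  have prod: "P (\<lambda>x. \<Prod>a\<in>A. g a x)" if "\<And>a. a \<in> A \<Longrightarrow> P (g a)" "finite A" for A :: "'a set" and g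
    using that(2,1) by (induction A rule: finite_induct) (auto intro: const mult)
  have sum: "P (\<lambda>x. \<Sum>a\<in>A. g a x)" if "\<And>a. a \<in> A \<Longrightarrow> P (g a)" "finite A" for A :: "('a \<Rightarrow> nat) set" and g
    using that(2,1) by (induction A rule: finite_induct) (auto intro: const add)
  show ?thesis
    using assms(1) unfolding hom_poly_def
    by (auto intro!: sum mult const prod power coord)
qed

section \<open>Points of projective space and Zariski closures\<close>

lemma proj_space_iff: "L \<in> proj_space W \<longleftrightarrow> (\<exists>w. w \<noteq> 0 \<and> L = vec.span {w} \<and> L \<subseteq> W)"
proof
  assume L: "L \<in> proj_space W"
  then have s: "vec.subspace L" "vec.dim L = 1" "L \<subseteq> W" by (auto simp: proj_space_def)
  obtain B where B: "B \<subseteq> L" "vec.independent B" "L \<subseteq> vec.span B" "card B = vec.dim L"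
    by (rule vec.basis_exists)
  then obtain w where w: "B = {w}" using s(2) by (metis card_1_singletonE)
  have "w \<noteq> 0" using B(2) w vec.dependent_zero by auto
  moreover have "L = vec.span {w}"
    using B(1,3) s(1) w by (metis vec.span_minimal subset_antisym)
  ultimately show "\<exists>w. w \<noteq> 0 \<and> L = vec.span {w} \<and> L \<subseteq> W" using s(3) by blast
next
  assume "\<exists>w. w \<noteq> 0 \<and> L = vec.span {w} \<and> L \<subseteq> W"
  then obtain w where w: "w \<noteq> 0" "L = vec.span {w}" "L \<subseteq> W" by blast
  have "vec.independent {w}" using w(1) by simp
  then have "vec.dim L = 1" using w(2) vec.dim_span_eq_card_independent by fastforce
  then show "L \<in> proj_space W" using w by (simp add: proj_space_def)
qed

lemma span_singleton_scale:
  fixes v :: "complex ^ 'n::finite"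
  assumes "c \<noteq> 0" shows "vec.span {c *s v} = vec.span {v}"
proof -
  have "inverse c *s (c *s v) \<in> vec.span {c *s v}" by (intro vec.span_scale vec.span_base) simp
  then have "v \<in> vec.span {c *s v}" using assms by (simp add: vec.scale_scale)
  moreover have "c *s v \<in> vec.span {v}" by (intro vec.span_scale vec.span_base) simp
  ultimately show ?thesis by (simp add: vec.span_eq)
qed

lemma span_singleton_in_proj_space:
  "w \<noteq> 0 \<Longrightarrow> vec.subspace W \<Longrightarrow> w \<in> W \<Longrightarrow> vec.span {w} \<in> proj_space W"
  unfolding proj_space_iff by (metis empty_subsetI insert_subset vec.span_minimal)

text \<open>Thanks to homogeneity a form may be tested on any one spanning vector of a line.\<close>

lemma vanishes_on_span_singleton:
  assumes "hom_poly d f"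
  shows "vanishes_on f {vec.span {w}} \<longleftrightarrow> f w = 0"
proof -
  have "vec.span {w} = range (\<lambda>k. k *s w)" by (rule vec.span_singleton)
  then show ?thesis
    using hom_poly_scale[OF assms] vec.span_base[of w "{w}"] by (auto simp: vanishes_on_def)
qed

text \<open>The points of projective space where all forms vanish that vanish on a given set of vectors, typically the image of an affine parametrisation.\<close>

definition zariski_closure :: "(complex ^ 'm::finite) set \<Rightarrow> (complex ^ 'm) set set" where
  "zariski_closure S =
    {L \<in> proj_space UNIV. \<forall>f. (\<exists>d. hom_poly d f) \<and> (\<forall>x\<in>S. f x = 0) \<longrightarrow> vanishes_on f {L}}"

lemma zariski_closed_closure: "zariski_closed (zariski_closure S)"
  unfolding zariski_closed_def zariski_closure_def
  by (rule exI[of _ "{f. (\<exists>d. hom_poly d f) \<and> (\<forall>x\<in>S. f x = 0)}"]) auto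

lemma span_in_zariski_closure: "x \<in> S \<Longrightarrow> x \<noteq> 0 \<Longrightarrow> vec.span {x} \<in> zariski_closure S"
  unfolding zariski_closure_def
  by (auto simp: vanishes_on_span_singleton intro: span_singleton_in_proj_space)

lemma zariski_closure_mono: "S \<subseteq> T \<Longrightarrow> zariski_closure S \<subseteq> zariski_closure T"
  unfolding zariski_closure_def by blast

lemma zariski_closure_subset:
  assumes "zariski_closed X" "\<And>x. x \<in> S \<Longrightarrow> vec.span {x} \<in> X"
  shows "zariski_closure S \<subseteq> X"
proof -
  obtain F where F: "\<forall>f\<in>F. \<exists>d. hom_poly d f" "X = {L \<in> proj_space UNIV. \<forall>f\<in>F. vanishes_on f {L}}"
    using assms(1) unfolding zariski_closed_def by blast
  have "f x = 0" if "f \<in> F" "x \<in> S" for f x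
    using assms(2)[OF that(2)] that(1) F vanishes_on_span_singleton by blast
  then show ?thesis using F unfolding zariski_closure_def by blast
qed

section \<open>Irreducible sets and chains from parametrisations\<close>

text \<open>Functions of infinitely many parameters that are polynomial on every line. Restricting to the line through two points transfers the absence of zero divisors from univariate polynomials.\<close>

definition line_poly :: "((nat \<Rightarrow> complex) \<Rightarrow> complex) \<Rightarrow> bool" where
  "line_poly h \<longleftrightarrow> (\<forall>x y. \<exists>p. \<forall>z. h (\<lambda>i. x i + z * (y i - x i)) = poly p z)"

lemma line_poly_const: "line_poly (\<lambda>_. c)"
  unfolding line_poly_def by (auto intro!: exI[of _ "[:c:]"])

lemma line_poly_coord: "line_poly (\<lambda>t. t i)"
  unfolding line_poly_def
  by (intro allI, rule_tac x = "[:x i, y i - x i:]" in exI) auto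

lemma line_poly_add: "line_poly f \<Longrightarrow> line_poly g \<Longrightarrow> line_poly (\<lambda>t. f t + g t)"
  unfolding line_poly_def by (metis poly_add)

lemma line_poly_mult: "line_poly f \<Longrightarrow> line_poly g \<Longrightarrow> line_poly (\<lambda>t. f t * g t)"
  unfolding line_poly_def by (metis poly_mult)

lemma line_poly_minus: "line_poly f \<Longrightarrow> line_poly (\<lambda>t. - f t)"
  using line_poly_mult[OF line_poly_const[of "-1"]] by simp

lemma line_poly_diff: "line_poly f \<Longrightarrow> line_poly g \<Longrightarrow> line_poly (\<lambda>t. f t - g t)"
  using line_poly_add[OF _ line_poly_minus] by fastforce

lemma line_poly_compose:
  assumes "hom_poly d f" "\<And>i. line_poly (\<lambda>t. \<psi> t $ i)"
  shows "line_poly (\<lambda>t. f (\<psi> t))"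
  by (rule hom_poly_induct[OF assms(1)]) (auto intro: line_poly_const assms line_poly_add line_poly_mult)

text \<open>On the line through \<open>x\<close> and \<open>y\<close> both functions become nonzero univariate polynomials, and their product has only finitely many roots.\<close>

lemma line_poly_no_zero_divisors:
  assumes "line_poly h" "line_poly k" "h x \<noteq> 0" "k y \<noteq> 0"
  obtains z where "h (\<lambda>i. x i + z * (y i - x i)) \<noteq> 0" "k (\<lambda>i. x i + z * (y i - x i)) \<noteq> 0"
proof -
  obtain p where p: "\<And>z. h (\<lambda>i. x i + z * (y i - x i)) = poly p z"
    using assms(1) unfolding line_poly_def by blast
  obtain q where q: "\<And>z. k (\<lambda>i. x i + z * (y i - x i)) = poly q z"
    using assms(2) unfolding line_poly_def by blast
  have "p \<noteq> 0" using p[of 0] assms(3) by auto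
  moreover have "q \<noteq> 0" using q[of 1] assms(4) by auto
  ultimately have "p * q \<noteq> 0" by simp
  then have "finite {z. poly (p * q) z = 0}" by (rule poly_roots_finite)
  then obtain z where "poly (p * q) z \<noteq> 0"
    using infinite_UNIV_char_0[where 'a = complex] by (metis (mono_tags, lifting) UNIV_eq_I mem_Collect_eq)
  then show ?thesis using that[of z] p q by auto
qed

text \<open>A proper closed subset of the closure of the image is cut out by a form that does not vanish identically along \<open>\<psi>\<close>. If the closure were the union of two such subsets, then at a suitable parameter neither of the two forms would vanish, and the corresponding point would lie in neither subset.\<close>

lemma irreducible_zariski_closure_image:
  assumes \<psi>: "\<And>i. line_poly (\<lambda>t. \<psi> t $ i)" and nz: "\<And>t. t \<in> T \<Longrightarrow> \<psi> t \<noteq> 0"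
    and ne: "T \<noteq> {}"
    and lines: "\<And>x y z. x \<in> T \<Longrightarrow> y \<in> T \<Longrightarrow> (\<lambda>i. x i + z * (y i - x i)) \<in> T"
  shows "irreducible_closed (zariski_closure (\<psi> ` T))"
proof -
  let ?Z = "zariski_closure (\<psi> ` T)"
  have inZ: "vec.span {\<psi> t} \<in> ?Z" if "t \<in> T" for t
    using that nz by (intro span_in_zariski_closure) auto
  have sep: "\<exists>t\<in>T. \<exists>d f. hom_poly d f \<and> f (\<psi> t) \<noteq> 0 \<and> vanishes_on f A"
    if A: "zariski_closed A" "A \<subseteq> ?Z" "A \<noteq> ?Z" for A
  proof -
    obtain F where F: "\<forall>f\<in>F. \<exists>d. hom_poly d f" "A = {L \<in> proj_space UNIV. \<forall>f\<in>F. vanishes_on f {L}}"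
      using A(1) unfolding zariski_closed_def by blast
    obtain t where t: "t \<in> T" "vec.span {\<psi> t} \<notin> A"
      using zariski_closure_subset[OF A(1), of "\<psi> ` T"] A(2,3) by blast
    then have "vec.span {\<psi> t} \<in> proj_space UNIV" using inZ zariski_closure_def by blast
    then obtain f where f: "f \<in> F" "\<not> vanishes_on f {vec.span {\<psi> t}}" using t F(2) by blast
    moreover have "vanishes_on f A" using f(1) F(2) by (auto simp: vanishes_on_def)
    ultimately show ?thesis using t(1) F(1) vanishes_on_span_singleton by blast
  qed
  have "A = ?Z \<or> B = ?Z" if AB: "zariski_closed A" "zariski_closed B" "?Z = A \<union> B" for A B
  proof (rule ccontr)
    assume "\<not> ?thesis"
    then have ne: "A \<subseteq> ?Z" "A \<noteq> ?Z" "B \<subseteq> ?Z" "B \<noteq> ?Z" using AB(3) by auto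
    obtain t d f where t: "t \<in> T" "hom_poly d f" "f (\<psi> t) \<noteq> 0" "vanishes_on f A"
      using sep[OF AB(1) ne(1,2)] by blast
    obtain s e g where s: "s \<in> T" "hom_poly e g" "g (\<psi> s) \<noteq> 0" "vanishes_on g B"
      using sep[OF AB(2) ne(3,4)] by blast
    obtain z where z: "f (\<psi> (\<lambda>i. t i + z * (s i - t i))) \<noteq> 0" "g (\<psi> (\<lambda>i. t i + z * (s i - t i))) \<noteq> 0"
      using line_poly_no_zero_divisors[OF line_poly_compose[OF t(2) \<psi>] line_poly_compose[OF s(2) \<psi>] t(3) s(3)]
      by blast
    let ?r = "\<lambda>i. t i + z * (s i - t i)"
    have "vec.span {\<psi> ?r} \<in> A \<union> B" using inZ[OF lines[OF t(1) s(1)]] AB(3) by blast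
    then show False
      using z t(4) s(4) vec.span_base[of "\<psi> ?r" "{\<psi> ?r}"] by (auto simp: vanishes_on_def)
  qed
  then show ?thesis
    unfolding irreducible_closed_def using zariski_closed_closure inZ ne by blast
qed

text \<open>The linear forms \<open>l k\<close> recover the parameters, so each step of the flag of affine subspaces through \<open>p\<close> spanned by the first \<open>i\<close> coordinate directions enlarges the closure of the image: the linear form \<open>l i - p i * l0\<close> vanishes on the smaller set and not on the larger one.\<close>

lemma local_dim_ge_of_chart:
  assumes X: "zariski_closed X"
    and \<psi>: "\<And>i. line_poly (\<lambda>t. \<psi> t $ i)"
    and inX: "\<And>t. vec.span {\<psi> t} \<in> X"
    and l0: "hom_poly 1 l0" "\<And>t. l0 (\<psi> t) = 1"
    and l: "\<And>k. k < n \<Longrightarrow> hom_poly 1 (l k)" "\<And>k t. k < n \<Longrightarrow> l k (\<psi> t) = t k"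
  shows "enat n \<le> local_dim X (vec.span {\<psi> p})"
proof -
  define T where "T i = {t. \<forall>k\<ge>i. t k = p k}" for i :: nat
  define Z where "Z i = zariski_closure (\<psi> ` T i)" for i
  have nz: "\<psi> t \<noteq> 0" for t
  proof
    assume "\<psi> t = 0"
    then have "l0 (\<psi> t) = 0" using hom_poly_scale[OF l0(1), of 0 0] by simp
    then show False using l0(2) by simp
  qed
  have pT: "p \<in> T i" for i by (simp add: T_def)
  have irr: "irreducible_closed (Z i)" for i
    unfolding Z_def
    by (rule irreducible_zariski_closure_image[OF \<psi> nz]) (use pT in \<open>auto simp: T_def\<close>)
  have strict: "Z i \<subset> Z (Suc i)" if "i < n" for i
  proof -
    have "T i \<subseteq> T (Suc i)" by (auto simp: T_def)
    then have sub: "Z i \<subseteq> Z (Suc i)" unfolding Z_def by (intro zariski_closure_mono image_mono)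
    let ?f = "\<lambda>x. l i x - p i * l0 x" and ?t = "p(i := p i + 1)"
    have f: "hom_poly 1 ?f" using l0 l that by (intro hom_poly_diff hom_poly_cmult)
    have "?f (\<psi> t) = 0" if "t \<in> T i" for t
      using that \<open>i < n\<close> l l0 by (auto simp: T_def)
    then have "vanishes_on ?f {L}" if "L \<in> Z i" for L
      using that f unfolding Z_def zariski_closure_def by blast
    moreover have "\<not> vanishes_on ?f {vec.span {\<psi> ?t}}"
      using vanishes_on_span_singleton[OF f] l l0 that by simp
    moreover have "vec.span {\<psi> ?t} \<in> Z (Suc i)"
      unfolding Z_def by (intro span_in_zariski_closure imageI nz) (auto simp: T_def)
    ultimately show ?thesis using sub by blast
  qed
  have LZ: "vec.span {\<psi> p} \<in> Z i" for i
    unfolding Z_def by (intro span_in_zariski_closure imageI pT nz)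
  have ZX: "Z i \<subseteq> X" for i
    unfolding Z_def by (rule zariski_closure_subset[OF X]) (use inX in auto)
  have "enat n \<in> {enat n | n. \<exists>Z :: nat \<Rightarrow> (complex ^ 'a) set set.
     (\<forall>i\<le>n. irreducible_closed (Z i) \<and> vec.span {\<psi> p} \<in> Z i \<and> Z i \<subseteq> X) \<and> (\<forall>i<n. Z i \<subset> Z (Suc i))}"
    using irr strict LZ ZX by (intro CollectI exI[of _ n] conjI exI[of _ Z]) auto
  then show ?thesis unfolding local_dim_def by (rule Sup_upper)
qed

section \<open>Bounding the dimension of a parametrised set\<close>

text \<open>Gaussian elimination: an equation in which some unknown \<open>h\<close> occurs is used to eliminate \<open>h\<close>.\<close>

lemma homogeneous_system_nontrivial_solution:
  fixes a :: "'a \<Rightarrow> 'b \<Rightarrow> 'c::field"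
  assumes "finite M" "finite G" "card M < card G"
  shows "\<exists>c. (\<exists>g\<in>G. c g \<noteq> 0) \<and> (\<forall>\<mu>\<in>M. (\<Sum>g\<in>G. c g * a g \<mu>) = 0)"
  using assms
proof (induction M arbitrary: G a rule: finite_induct)
  case empty
  then have "G \<noteq> {}" by auto
  then show ?case by (intro exI[of _ "\<lambda>_. 1"]) auto
next
  case (insert \<nu> M)
  show ?case
  proof (cases "\<forall>g\<in>G. a g \<nu> = 0")
    case True
    have "card M < card G" using insert.hyps insert.prems by simp
    then obtain c where "\<exists>g\<in>G. c g \<noteq> 0" "\<forall>\<mu>\<in>M. (\<Sum>g\<in>G. c g * a g \<mu>) = 0"
      using insert.IH[OF insert.prems(1)] by blast
    then show ?thesis using True by (intro exI[of _ c]) auto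
  next
    case False
    then obtain h where h: "h \<in> G" "a h \<nu> \<noteq> 0" by blast
    let ?G = "G - {h}" and ?a = "\<lambda>g \<mu>. a g \<mu> - a g \<nu> / a h \<nu> * a h \<mu>"
    have "card M < card ?G" using insert.hyps insert.prems h by simp
    then obtain c where c: "\<exists>g\<in>?G. c g \<noteq> 0" "\<forall>\<mu>\<in>M. (\<Sum>g\<in>?G. c g * ?a g \<mu>) = 0"
      using insert.IH[of ?G ?a] insert.prems(1) by blast
    define e where "e = c(h := - (\<Sum>g\<in>?G. c g * a g \<nu>) / a h \<nu>)"
    have split: "(\<Sum>g\<in>G. e g * a g \<mu>) = (\<Sum>g\<in>?G. c g * ?a g \<mu>)" for \<mu>
    proof -
      have "(\<Sum>g\<in>G. e g * a g \<mu>) = e h * a h \<mu> + (\<Sum>g\<in>?G. e g * a g \<mu>)"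
        using insert.prems(1) h(1) by (rule sum.remove)
      also have "(\<Sum>g\<in>?G. e g * a g \<mu>) = (\<Sum>g\<in>?G. c g * a g \<mu>)"
        by (rule sum.cong) (auto simp: e_def)
      also have "e h * a h \<mu> = - (\<Sum>g\<in>?G. c g * (a g \<nu> / a h \<nu> * a h \<mu>))"
        by (simp add: e_def sum_divide_distrib sum_distrib_left mult_ac)
      finally show ?thesis by (simp add: sum_subtractf right_diff_distrib)
    qed
    have "(\<Sum>g\<in>?G. c g * ?a g \<nu>) = 0" using h by simp
    then have "\<forall>\<mu>\<in>insert \<nu> M. (\<Sum>g\<in>G. e g * a g \<mu>) = 0" using c(2) split by simp
    moreover have "\<exists>g\<in>G. e g \<noteq> 0" using c(1) by (auto simp: e_def)
    ultimately show ?thesis by blast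
  qed
qed

text \<open>An exponent vector of fixed total degree is determined by all of its entries but one.\<close>

lemma card_exponents_le:
  fixes N :: nat
  defines "M \<equiv> {m :: 'k::finite \<Rightarrow> nat. (\<Sum>i\<in>UNIV. m i) = N}"
  shows "finite M" "card M \<le> (N + 1) ^ (CARD('k) - 1)"
proof -
  fix j :: 'k
  let ?r = "\<lambda>m. restrict m (UNIV - {j})"
  let ?P = "PiE (UNIV - {j}) (\<lambda>_. {..N})"
  have "inj_on ?r M"
  proof (rule inj_onI)
    fix m n assume mn: "m \<in> M" "n \<in> M" "?r m = ?r n"
    have eq: "m i = n i" if "i \<noteq> j" for i
      using fun_cong[OF mn(3), of i] that by simp
    have "m j + (\<Sum>i\<in>UNIV - {j}. m i) = n j + (\<Sum>i\<in>UNIV - {j}. n i)"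
      using mn(1,2) by (simp add: M_def flip: sum.remove)
    then have "m j = n j" using eq by simp
    then show "m = n" using eq by (metis ext)
  qed
  moreover have "?r ` M \<subseteq> ?P"
  proof -
    have "m i \<le> N" if "m \<in> M" for m i
      using that member_le_sum[of i UNIV m] by (simp add: M_def)
    then show ?thesis by (intro image_subsetI) (simp add: restrict_PiE_iff)
  qed
  moreover have "finite ?P" by (simp add: finite_PiE)
  ultimately show "finite M" "card M \<le> (N + 1) ^ (CARD('k) - 1)"
    using inj_on_finite card_inj_on_le[of ?r M ?P] by (auto simp: card_PiE card_Diff_singleton)
qed

definition lin_indep_on :: "(complex ^ 'm::finite \<Rightarrow> complex) set \<Rightarrow> (complex ^ 'm) set set \<Rightarrow> bool" where
  "lin_indep_on G X \<longleftrightarrow> (\<forall>c. vanishes_on (\<lambda>x. \<Sum>g\<in>G. c g * g x) X \<longrightarrow> (\<forall>g\<in>G. c g = 0))"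

lemma vanishes_on_mono: "vanishes_on f X \<Longrightarrow> Y \<subseteq> X \<Longrightarrow> vanishes_on f Y"
  unfolding vanishes_on_def by blast

text \<open>Irreducibility in terms of forms: the ideal of an irreducible closed set is prime.\<close>

lemma irreducible_closed_vanishes_mult:
  assumes Z: "irreducible_closed Z" and fg: "hom_poly d f" "hom_poly e g" "vanishes_on (\<lambda>x. f x * g x) Z"
  shows "vanishes_on f Z \<or> vanishes_on g Z"
proof -
  obtain F where F: "\<forall>f\<in>F. \<exists>d. hom_poly d f" "Z = {L \<in> proj_space UNIV. \<forall>f\<in>F. vanishes_on f {L}}"
    using Z unfolding irreducible_closed_def zariski_closed_def by blast
  have cut: "zariski_closed {L \<in> Z. vanishes_on h {L}}" if "hom_poly d h" for h d
    unfolding zariski_closed_def using F that by (intro exI[of _ "insert h F"]) auto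
  have "L \<in> {L \<in> Z. vanishes_on f {L}} \<union> {L \<in> Z. vanishes_on g {L}}" if L: "L \<in> Z" for L
  proof -
    obtain w where w: "L = vec.span {w}" using L F(2) proj_space_iff by blast
    then have "f w * g w = 0" using fg(3) L vec.span_base[of w "{w}"] by (auto simp: vanishes_on_def)
    then show ?thesis using w L fg(1,2) by (auto simp: vanishes_on_span_singleton)
  qed
  then have cover: "Z = {L \<in> Z. vanishes_on f {L}} \<union> {L \<in> Z. vanishes_on g {L}}" by blast
  have cases:  "A = Z \<or> B = Z" if "zariski_closed A" "zariski_closed B" "Z = A \<union> B" for A B
    using Z that unfolding irreducible_closed_def by blast
  have "{L \<in> Z. vanishes_on f {L}} = Z \<or> {L \<in> Z. vanishes_on g {L}} = Z"
    by (rule cases[OF cut[OF fg(1)] cut[OF fg(2)] cover])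
  then show ?thesis by (auto simp: vanishes_on_def)
qed

text \<open>A relation among the forms of \<open>G\<close> and of \<open>f H\<close> on \<open>Z\<close> restricts to a relation among those of \<open>G\<close> on \<open>Y\<close>, because \<open>f\<close> vanishes there; what remains is divisible by \<open>f\<close>, which can be cancelled on the irreducible set \<open>Z\<close>.\<close>

lemma lin_indep_on_Un_mult:
  assumes Z: "irreducible_closed Z" "Y \<subseteq> Z"
    and f: "hom_poly D f" "vanishes_on f Y" "\<not> vanishes_on f Z"
    and G: "finite G" "lin_indep_on G Y"
    and H: "finite H" "lin_indep_on H Z" "\<And>h. h \<in> H \<Longrightarrow> hom_poly e h"
  defines "fH \<equiv> (\<lambda>h x. f x * h x) ` H"
  shows "lin_indep_on (G \<union> fH) Z" "card (G \<union> fH) = card G + card H"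
proof -
  have cancel: "\<forall>h\<in>H. c h = 0" if "vanishes_on (\<lambda>x. \<Sum>h\<in>H. c h * (f x * h x)) Z" for c
  proof -
    have "(\<lambda>x. \<Sum>h\<in>H. c h * (f x * h x)) = (\<lambda>x. f x * (\<Sum>h\<in>H. c h * h x))"
      by (simp add: sum_distrib_left mult_ac)
    then have "vanishes_on (\<lambda>x. f x * (\<Sum>h\<in>H. c h * h x)) Z" using that by simp
    moreover have "hom_poly e (\<lambda>x. \<Sum>h\<in>H. c h * h x)"
      using H(3) by (intro hom_poly_sum hom_poly_cmult)
    ultimately have "vanishes_on (\<lambda>x. \<Sum>h\<in>H. c h * h x) Z"
      using irreducible_closed_vanishes_mult[OF Z(1) f(1)] f(3) by blast
    then show ?thesis using H(2) by (simp add: lin_indep_on_def)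
  qed
  have inj: "inj_on (\<lambda>h x. f x * h x) H"
  proof (rule inj_onI, rule ccontr)
    fix h k assume hk: "h \<in> H" "k \<in> H" "(\<lambda>x. f x * h x) = (\<lambda>x. f x * k x)" "h \<noteq> k"
    define c where "c l = (if l = h then 1 else 0) - (if l = k then 1 else (0::complex))" for l
    have "(\<Sum>l\<in>H. c l * (f x * l x)) = f x * h x - f x * k x" for x
      unfolding c_def left_diff_distrib sum_subtractf using H(1) hk(1,2)
      by (simp add: if_distrib[of "\<lambda>t. t * _"] cong: if_cong)
    then have "vanishes_on (\<lambda>x. \<Sum>l\<in>H. c l * (f x * l x)) Z"
      using fun_cong[OF hk(3)] by (simp add: vanishes_on_def)
    then show False using cancel hk(1,4) by (force simp: c_def)
  qed
  have disj: "G \<inter> fH = {}"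
  proof (rule ccontr)
    assume "G \<inter> fH \<noteq> {}"
    then obtain h where h: "(\<lambda>x. f x * h x) \<in> G" unfolding fH_def by blast
    let ?k = "\<lambda>x. f x * h x"
    have "(\<Sum>g\<in>G. (if g = ?k then 1 else 0) * g x) = ?k x" for x
      using G(1) h by (simp add: if_distrib[of "\<lambda>t. t * _"] cong: if_cong)
    then have "vanishes_on (\<lambda>x. \<Sum>g\<in>G. (if g = ?k then 1 else 0) * g x) Y"
      using f(2) by (simp add: vanishes_on_def)
    then have "\<forall>g\<in>G. (if g = ?k then 1 else 0) = (0::complex)"
      using spec[OF G(2)[unfolded lin_indep_on_def], of "\<lambda>g. if g = ?k then 1 else 0"] by simp
    then show False using h by auto
  qed
  have fin: "finite fH" using H(1) by (simp add: fH_def)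
  show "card (G \<union> fH) = card G + card H"
    using G(1) fin disj inj by (simp add: card_Un_disjoint fH_def card_image)
  have "\<forall>g\<in>G \<union> fH. c g = 0" if c: "vanishes_on (\<lambda>x. \<Sum>g\<in>G \<union> fH. c g * g x) Z" for c
  proof -
    have split: "(\<Sum>g\<in>G \<union> fH. c g * g x) =
        (\<Sum>g\<in>G. c g * g x) + (\<Sum>h\<in>H. c (\<lambda>x. f x * h x) * (f x * h x))" for x
      using G(1) fin disj by (simp add: sum.union_disjoint) (simp add: fH_def sum.reindex[OF inj])
    have "vanishes_on (\<lambda>x. \<Sum>g\<in>G. c g * g x) Y"
      using vanishes_on_mono[OF c Z(2)] f(2) unfolding split by (simp add: vanishes_on_def)
    then have G0: "\<forall>g\<in>G. c g = 0" using G(2) by (simp add: lin_indep_on_def)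
    then have "vanishes_on (\<lambda>x. \<Sum>h\<in>H. c (\<lambda>x. f x * h x) * (f x * h x)) Z"
      using c unfolding split by simp
    then have "\<forall>h\<in>H. c (\<lambda>x. f x * h x) = 0" by (rule cancel)
    then show ?thesis using G0 by (auto simp: fH_def)
  qed
  then show "lin_indep_on (G \<union> fH) Z" by (simp add: lin_indep_on_def)
qed

lemma lin_indep_on_singleton:
  assumes "\<not> vanishes_on g Z" shows "lin_indep_on {g} Z"
  using assms by (auto simp: lin_indep_on_def vanishes_on_def)

text \<open>The forms are the monomials of degree \<open>d\<close> in \<open>f 0, \<dots>, f i\<close>. Sorting them by whether \<open>f i\<close> occurs turns Pascal's rule into the induction step.\<close>

lemma many_independent_forms:
  assumes Z: "\<And>i. i \<le> n \<Longrightarrow> irreducible_closed (Z i)" "\<And>i. i < n \<Longrightarrow> Z i \<subseteq> Z (Suc i)"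
    and f: "\<And>i. i \<le> n \<Longrightarrow> hom_poly D (f i)" "\<And>i. i \<le> n \<Longrightarrow> \<not> vanishes_on (f i) (Z i)"
      "\<And>i. i < n \<Longrightarrow> vanishes_on (f (Suc i)) (Z i)"
    and i: "i \<le> n"
  shows "\<exists>G. finite G \<and> card G = (i + d) choose i \<and> (\<forall>g\<in>G. hom_poly (d * D) g) \<and> lin_indep_on G (Z i)"
  using i
proof (induction i arbitrary: d)
  case 0
  have "\<not> vanishes_on (\<lambda>x. f 0 x ^ d) (Z 0)"
    using f(2)[of 0] by (auto simp: vanishes_on_def)
  then show ?case
    by (intro exI[of _ "{\<lambda>x. f 0 x ^ d}"])
      (auto intro: lin_indep_on_singleton hom_poly_power f(1))
next
  case (Suc i)
  have prev: "\<exists>G. finite G \<and> card G = (i + d) choose i \<and> (\<forall>g\<in>G. hom_poly (d * D) g) \<and> lin_indep_on G (Z i)"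
    for d using Suc by simp
  show ?case
  proof (induction d)
    case 0
    have "\<not> vanishes_on (\<lambda>_. 1) (Z (Suc i))"
      using f(2)[OF Suc.prems] by (auto simp: vanishes_on_def)
    then show ?case
      by (intro exI[of _ "{\<lambda>_. 1}"]) (auto intro: lin_indep_on_singleton hom_poly_const)
  next
    case (Suc d)
    obtain G where G: "finite G" "card G = (i + Suc d) choose i"
      "\<forall>g\<in>G. hom_poly (Suc d * D) g" "lin_indep_on G (Z i)"
      using prev[of "Suc d"] by blast
    obtain H where H: "finite H" "card H = (Suc i + d) choose Suc i"
      "\<forall>h\<in>H. hom_poly (d * D) h" "lin_indep_on H (Z (Suc i))"
      using Suc.IH by blast
    let ?fH = "(\<lambda>h x. f (Suc i) x * h x) ` H"
    have "lin_indep_on (G \<union> ?fH) (Z (Suc i))" "card (G \<union> ?fH) = card G + card H"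
      using lin_indep_on_Un_mult[of "Z (Suc i)" "Z i" D "f (Suc i)" G H "d * D"] Z f G H \<open>Suc i \<le> n\<close>
      by auto
    moreover have "\<forall>g\<in>G \<union> ?fH. hom_poly (Suc d * D) g"
      using G(3) H(3) hom_poly_mult[OF f(1)[OF \<open>Suc i \<le> n\<close>]] by auto
    ultimately show ?case
      using G(1,2) H(1,2) by (intro exI[of _ "G \<union> ?fH"]) simp
  qed
qed

text \<open>Suppose that a chain of length \<open>k = CARD('k)\<close> exists. It provides a number of independent forms that grows with the \<open>k\<close>-th power of their degree. Pulled back along \<open>\<phi>\<close> they remain independent by \<open>dense\<close>, but they lie in a space of forms in \<open>k\<close> variables, whose dimension only grows with the power \<open>k - 1\<close>.\<close>

lemma local_dim_le_of_parametrisation: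
  fixes \<phi> :: "complex ^ 'k::finite \<Rightarrow> complex ^ 'm::finite"
  assumes \<phi>: "\<And>i. hom_poly e (\<lambda>x. \<phi> x $ i)"
    and dense: "\<And>d f. hom_poly d f \<Longrightarrow> (\<And>x. f (\<phi> x) = 0) \<Longrightarrow> vanishes_on f X"
  shows "local_dim X L \<le> enat (CARD('k) - 1)"
proof -
  let ?k = "CARD('k)"
  have "n \<le> ?k - 1" if chain: "\<forall>i\<le>n. irreducible_closed (Z i) \<and> L \<in> Z i \<and> Z i \<subseteq> X"
      "\<forall>i<n. Z i \<subset> Z (Suc i)" for n Z
  proof (rule ccontr)
    assume "\<not> n \<le> ?k - 1"
    then have kn: "?k \<le> n" by simp
    have irr: "irreducible_closed (Z i)" if "i \<le> ?k" for i using chain kn that by simp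
    have sub: "Z i \<subseteq> Z (Suc i)" if "i < ?k" for i
      using chain(2) less_le_trans[OF that kn] by blast
    have LZ: "L \<in> Z i" if "i \<le> ?k" for i using chain kn that by simp
    have "\<exists>f d. hom_poly d f \<and> vanishes_on f (Z i) \<and> \<not> vanishes_on f (Z (Suc i))" if i: "i < ?k" for i
    proof -
      obtain F where F: "\<forall>f\<in>F. \<exists>d. hom_poly d f" "Z i = {L \<in> proj_space UNIV. \<forall>f\<in>F. vanishes_on f {L}}"
        using irr[of i] i unfolding irreducible_closed_def zariski_closed_def by auto
      obtain M where M: "M \<in> Z (Suc i)" "M \<notin> Z i" using chain(2) less_le_trans[OF i kn] by blast
      have "M \<in> proj_space UNIV"
        using M(1) irr[of "Suc i"] i unfolding irreducible_closed_def zariski_closed_def by auto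
      then obtain f where f: "f \<in> F" "\<not> vanishes_on f {M}" using M(2) F(2) by blast
      obtain d where "hom_poly d f" using F(1) f(1) by blast
      moreover have "vanishes_on f (Z i)" using F(2) f(1) by (auto simp: vanishes_on_def)
      moreover have "\<not> vanishes_on f (Z (Suc i))"
        using vanishes_on_mono[of f "Z (Suc i)" "{M}"] f(2) M(1) by blast
      ultimately show ?thesis by blast
    qed
    then obtain f \<delta> where f: "\<And>i. i < ?k \<Longrightarrow> hom_poly (\<delta> i) (f i)"
        "\<And>i. i < ?k \<Longrightarrow> vanishes_on (f i) (Z i)" "\<And>i. i < ?k \<Longrightarrow> \<not> vanishes_on (f i) (Z (Suc i))"
      by metis
    obtain w where w: "w \<noteq> 0" "L = vec.span {w}"
    proof -
      have "L \<in> proj_space UNIV"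
        using LZ[of 0] irr[of 0] unfolding irreducible_closed_def zariski_closed_def by auto
      then show ?thesis using that by (auto simp: proj_space_iff)
    qed
    obtain j where j: "w $ j \<noteq> 0" using w(1) by (metis vec_eq_iff zero_index)
    define D where "D = (\<Sum>i<?k. \<delta> i)"
    have \<delta>D: "\<delta> i \<le> D" if "i < ?k" for i
      unfolding D_def using that by (intro member_le_sum) auto
    \<comment> \<open>Multiplying by powers of a coordinate that is nonzero on \<open>L\<close> gives all forms the same degree \<open>D\<close> without creating zeros on the sets \<open>Z i\<close>, all of which contain \<open>L\<close>.\<close>
    define h where "h i = (case i of 0 \<Rightarrow> \<lambda>x. x $ j ^ D | Suc i \<Rightarrow> \<lambda>x. f i x * x $ j ^ (D - \<delta> i))" for i
    have xpow: "hom_poly a (\<lambda>x::complex^'m. x $ j ^ a)" for a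
      using hom_poly_power[OF hom_poly_coord, of a j] by simp
    have xnz: "\<not> vanishes_on (\<lambda>x. x $ j ^ a) (Z i)" if "i \<le> ?k" for a i
      using LZ[OF that] w(2) j vec.span_base[of w "{w}"] by (auto simp: vanishes_on_def)
    have h1: "hom_poly D (h i)" if "i \<le> ?k" for i
      using that xpow[of D] hom_poly_mult[OF f(1) xpow, of "i - 1" "D - \<delta> (i - 1)"] \<delta>D[of "i - 1"]
      by (cases i) (auto simp: h_def)
    have h2: "\<not> vanishes_on (h i) (Z i)" if "i \<le> ?k" for i
    proof (cases i)
      case 0 then show ?thesis using xnz[of 0 D] by (simp add: h_def)
    next
      case (Suc l)
      then show ?thesis
        using irreducible_closed_vanishes_mult[OF irr[OF that] f(1)[of l] xpow] xnz[OF that] f(3)[of l] that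
        by (auto simp: h_def)
    qed
    have h3: "vanishes_on (h (Suc i)) (Z i)" if "i < ?k" for i
      using f(2)[OF that] by (simp add: h_def vanishes_on_def)
    define E where "E = ?k * D * e"
    \<comment> \<open>With degree parameter \<open>k m\<close> there are at least \<open>(m + 1)\<^sup>k\<close> forms and at most \<open>m (m + 1)\<^bsup>k - 1\<^esup>\<close> monomials for them to pull back to.\<close>
    define m where "m = (E + 1) ^ (?k - 1)"
    obtain G where G: "finite G" "card G = (?k + ?k * m) choose ?k"
      "\<forall>g\<in>G. hom_poly (?k * m * D) g" "lin_indep_on G (Z ?k)"
      using many_independent_forms[of ?k Z D h ?k "?k * m", OF irr sub h1 h2 h3 order_refl] by blast
    define M where "M = {\<mu> :: 'k \<Rightarrow> nat. (\<Sum>i\<in>UNIV. \<mu> i) = ?k * m * D * e}"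
    define mon where "mon \<mu> x = (\<Prod>i\<in>UNIV. (x $ i) ^ \<mu> i)" for \<mu> :: "'k \<Rightarrow> nat" and x :: "complex ^ 'k"
    have finM: "finite M" and cardM: "card M \<le> (?k * m * D * e + 1) ^ (?k - 1)"
      using card_exponents_le[where 'k = 'k, of "?k * m * D * e"] by (auto simp: M_def)
    have "\<exists>a. \<forall>x. g (\<phi> x) = (\<Sum>\<mu>\<in>M. a \<mu> * mon \<mu> x)" if g: "g \<in> G" for g
    proof -
      obtain N c where N: "finite N" "\<forall>\<mu>\<in>N. (\<Sum>i\<in>UNIV. \<mu> i) = ?k * m * D * e"
        "(\<lambda>x. g (\<phi> x)) = (\<lambda>x. \<Sum>\<mu>\<in>N. c \<mu> * (\<Prod>i\<in>UNIV. (x $ i) ^ \<mu> i))"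
        using hom_poly_compose[OF G(3)[rule_format, OF g] \<phi>] unfolding hom_poly_def by blast
      have "g (\<phi> x) = (\<Sum>\<mu>\<in>M. (if \<mu> \<in> N then c \<mu> else 0) * mon \<mu> x)" for x
        unfolding fun_cong[OF N(3)] mon_def
        by (rule sum.mono_neutral_cong_left) (use N finM in \<open>auto simp: M_def\<close>)
      then show ?thesis by (intro exI[of _ "\<lambda>\<mu>. if \<mu> \<in> N then c \<mu> else 0"] allI)
    qed
    then obtain a where a: "\<And>g x. g \<in> G \<Longrightarrow> g (\<phi> x) = (\<Sum>\<mu>\<in>M. a g \<mu> * mon \<mu> x)" by metis
    have "card M < card G"
    proof -
      have "card M \<le> (?k * m * D * e + 1) ^ (?k - 1)" by (rule cardM)
      also have "\<dots> \<le> ((E + 1) * (m + 1)) ^ (?k - 1)"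
        by (intro power_mono) (auto simp: E_def algebra_simps)
      also have "\<dots> = m * (m + 1) ^ (?k - 1)" 
        unfolding power_mult_distrib m_def[symmetric] ..
      also have "\<dots> < (m + 1) * (m + 1) ^ (?k - 1)" by simp
      also have "\<dots> = (m + 1) ^ ?k" by (metis Suc_diff_1 power_Suc zero_less_card_finite)
      also have "\<dots> \<le> card G"
      proof -
        have "(real (?k + ?k * m) / real ?k) ^ ?k \<le> real ((?k + ?k * m) choose ?k)"
          using binomial_ge_n_over_k_pow_k[of ?k "?k + ?k * m", where 'a = real] by simp
        moreover have "real (?k + ?k * m) / real ?k = real (m + 1)" by (simp add: field_simps)
        ultimately have "real ((m + 1) ^ ?k) \<le> real ((?k + ?k * m) choose ?k)" by simp
        then show ?thesis unfolding G(2) of_nat_le_iff .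
      qed
      finally show ?thesis .
    qed
    then obtain c where c: "\<exists>g\<in>G. c g \<noteq> 0" "\<forall>\<mu>\<in>M. (\<Sum>g\<in>G. c g * a g \<mu>) = 0"
      using homogeneous_system_nontrivial_solution[OF finM G(1), of a] by blast
    have "(\<Sum>g\<in>G. c g * g (\<phi> x)) = 0" for x
    proof -
      have "(\<Sum>g\<in>G. c g * g (\<phi> x)) = (\<Sum>g\<in>G. \<Sum>\<mu>\<in>M. c g * a g \<mu> * mon \<mu> x)"
        by (simp add: a sum_distrib_left mult.assoc)
      also have "\<dots> = (\<Sum>\<mu>\<in>M. (\<Sum>g\<in>G. c g * a g \<mu>) * mon \<mu> x)"
        by (subst sum.swap) (simp add: sum_distrib_right)
      finally show ?thesis using c(2) by simp
    qed
    moreover have "hom_poly (?k * m * D) (\<lambda>x. \<Sum>g\<in>G. c g * g x)"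
      using G(3) by (intro hom_poly_sum hom_poly_cmult) blast
    ultimately have "vanishes_on (\<lambda>x. \<Sum>g\<in>G. c g * g x) X" by (intro dense)
    then have "vanishes_on (\<lambda>x. \<Sum>g\<in>G. c g * g x) (Z ?k)"
      by (rule vanishes_on_mono) (use chain(1) kn in blast)
    then show False using G(4) c(1) by (auto simp: lin_indep_on_def)
  qed
  then show ?thesis unfolding local_dim_def by (intro Sup_least) auto
qed

section \<open>Tangent vectors\<close>

text \<open>The chain rule for forms, stated along arbitrary curves because it is used both for straight lines and for curves lying on the variety.\<close>

lemma hom_poly_gradient:
  assumes "hom_poly d f"
  obtains g where "\<And>\<gamma> u. \<gamma> 0 = w \<Longrightarrow> (\<And>i. ((\<lambda>t. \<gamma> t $ i) has_field_derivative u $ i) (at 0)) \<Longrightarrow>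
    ((\<lambda>t. f (\<gamma> t)) has_field_derivative (\<Sum>i\<in>UNIV. g i * u $ i)) (at 0)"
proof -
  have "\<exists>g. \<forall>\<gamma> u. \<gamma> 0 = w \<longrightarrow> (\<forall>i. ((\<lambda>t. \<gamma> t $ i) has_field_derivative u $ i) (at 0)) \<longrightarrow>
    ((\<lambda>t. f (\<gamma> t)) has_field_derivative (\<Sum>i\<in>UNIV. g i * u $ i)) (at 0)" (is "\<exists>g. ?D f g")
  proof (rule hom_poly_induct[OF assms])
    show "\<exists>g. ?D (\<lambda>_. c) g" for c by (rule exI[of _ "\<lambda>_. 0"]) auto
    show "\<exists>g. ?D (\<lambda>x. x $ i) g" for i
      by (rule exI[of _ "\<lambda>j. if j = i then 1 else 0"]) (auto simp: if_distrib[of "\<lambda>t. t * _"] cong: if_cong)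
  next
    fix f1 f2 assume "\<exists>g. ?D f1 g" "\<exists>g. ?D f2 g"
    then obtain g1 g2 where g: "?D f1 g1" "?D f2 g2" by blast
    have "?D (\<lambda>x. f1 x + f2 x) (\<lambda>i. g1 i + g2 i)"
      using g by (auto simp: distrib_right sum.distrib intro!: DERIV_add)
    then show "\<exists>g. ?D (\<lambda>x. f1 x + f2 x) g" by (rule exI[of "?D (\<lambda>x. f1 x + f2 x)"])
    have "?D (\<lambda>x. f1 x * f2 x) (\<lambda>i. f2 w * g1 i + f1 w * g2 i)"
    proof (intro allI impI)
      fix \<gamma> u assume "\<gamma> 0 = w" "\<forall>i. ((\<lambda>t. \<gamma> t $ i) has_field_derivative u $ i) (at 0)"
      then have "((\<lambda>t. f1 (\<gamma> t) * f2 (\<gamma> t)) has_field_derivative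
          (\<Sum>i\<in>UNIV. g1 i * u $ i) * f2 (\<gamma> 0) + (\<Sum>i\<in>UNIV. g2 i * u $ i) * f1 (\<gamma> 0)) (at 0)"
        using g by (intro DERIV_mult) auto
      also have "(\<Sum>i\<in>UNIV. g1 i * u $ i) * f2 (\<gamma> 0) + (\<Sum>i\<in>UNIV. g2 i * u $ i) * f1 (\<gamma> 0) =
          (\<Sum>i\<in>UNIV. (f2 w * g1 i + f1 w * g2 i) * u $ i)"
        using \<open>\<gamma> 0 = w\<close> by (simp add: distrib_right distrib_left sum.distrib sum_distrib_left sum_distrib_right mult_ac)
      finally show "((\<lambda>t. f1 (\<gamma> t) * f2 (\<gamma> t)) has_field_derivative
          (\<Sum>i\<in>UNIV. (f2 w * g1 i + f1 w * g2 i) * u $ i)) (at 0)" .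
    qed
    then show "\<exists>g. ?D (\<lambda>x. f1 x * f2 x) g" by (rule exI[of "?D (\<lambda>x. f1 x * f2 x)"])
  qed
  then show ?thesis using that by blast
qed

lemma line_coord_derivative:
  "((\<lambda>t. (w + t *s u) $ i) has_field_derivative u $ i) (at 0)"
  by (auto intro!: derivative_eq_intros)

lemma subspace_cone_tangent_space: "vec.subspace (cone_tangent_space X L)"
proof (rule vec.subspaceI)
  have "((\<lambda>t. f (w + t *s (a *s u + b *s v))) has_field_derivative 0) (at 0)"
    if uv: "u \<in> cone_tangent_space X L" "v \<in> cone_tangent_space X L"
      and f: "hom_poly d f" "vanishes_on f X" and w: "w \<in> L - {0}" for a b u v d f w
  proof -
    obtain g where g: "\<And>\<gamma> u. \<gamma> 0 = w \<Longrightarrow> (\<And>i. ((\<lambda>t. \<gamma> t $ i) has_field_derivative u $ i) (at 0)) \<Longrightarrow>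
      ((\<lambda>t. f (\<gamma> t)) has_field_derivative (\<Sum>i\<in>UNIV. g i * u $ i)) (at 0)"
      using hom_poly_gradient[OF f(1), of w] by blast
    have d: "((\<lambda>t. f (w + t *s u)) has_field_derivative (\<Sum>i\<in>UNIV. g i * u $ i)) (at 0)" for u
      by (rule g[OF _ line_coord_derivative]) simp
    have "(\<Sum>i\<in>UNIV. g i * u $ i) = 0" if "u \<in> cone_tangent_space X L" for u
      using that f w DERIV_unique[OF d] unfolding cone_tangent_space_def by blast
    then have "a * (\<Sum>i\<in>UNIV. g i * u $ i) + b * (\<Sum>i\<in>UNIV. g i * v $ i) = 0"
      using uv by simp
    then have "(\<Sum>i\<in>UNIV. g i * (a *s u + b *s v) $ i) = 0"
      by (simp add: distrib_left sum.distrib sum_distrib_left mult_ac)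
    then show ?thesis using d[of "a *s u + b *s v"] by simp
  qed
  then have comb: "a *s u + b *s v \<in> cone_tangent_space X L"
    if "u \<in> cone_tangent_space X L" "v \<in> cone_tangent_space X L" for a b u v
    using that unfolding cone_tangent_space_def by blast
  show "0 \<in> cone_tangent_space X L" by (simp add: cone_tangent_space_def)
  show "x + y \<in> cone_tangent_space X L"
    if "x \<in> cone_tangent_space X L" "y \<in> cone_tangent_space X L" for x y
    using comb[OF that, of 1 1] by simp
  show "c *s x \<in> cone_tangent_space X L" if "x \<in> cone_tangent_space X L" for c x
    using comb[OF that that, of c 0] by simp
qed

text \<open>Forms that vanish on \<open>X\<close> are constant along \<open>\<gamma>\<close>, so their gradient at \<open>\<gamma> 0\<close> annihilates the velocity; homogeneity carries this to the other vectors of the line.\<close>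

lemma cone_tangent_spaceI_curve:
  assumes \<gamma>0: "\<gamma> 0 \<noteq> 0"
    and \<gamma>: "\<And>t. \<exists>L\<in>X. \<gamma> t \<in> L"
    and deriv: "\<And>i. ((\<lambda>t. \<gamma> t $ i) has_field_derivative u $ i) (at 0)"
  shows "u \<in> cone_tangent_space X (vec.span {\<gamma> 0})"
proof -
  have "((\<lambda>t. f (w + t *s u)) has_field_derivative 0) (at 0)"
    if f: "hom_poly d f" "vanishes_on f X" and w: "w \<in> vec.span {\<gamma> 0} - {0}" for d f w
  proof -
    obtain g where g: "\<And>\<gamma> u. \<gamma> 0 = w \<Longrightarrow> (\<And>i. ((\<lambda>t. \<gamma> t $ i) has_field_derivative u $ i) (at 0)) \<Longrightarrow>
      ((\<lambda>t. f (\<gamma> t)) has_field_derivative (\<Sum>i\<in>UNIV. g i * u $ i)) (at 0)"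
      using hom_poly_gradient[OF f(1), of w] by blast
    obtain c where c: "w = c *s \<gamma> 0" using w by (auto simp: vec.span_singleton)
    then have "c \<noteq> 0" using w by auto
    have "((\<lambda>t. f (c *s \<gamma> t)) has_field_derivative (\<Sum>i\<in>UNIV. g i * (c *s u) $ i)) (at 0)"
      using c deriv by (intro g) (auto intro!: derivative_eq_intros)
    moreover have "f (c *s \<gamma> t) = 0" for t
      using \<gamma>[of t] f by (auto simp: hom_poly_scale[OF f(1)] vanishes_on_def)
    ultimately have "(\<Sum>i\<in>UNIV. g i * (c *s u) $ i) = 0"
      using DERIV_unique[OF _ DERIV_const] by auto
    then have "c * (\<Sum>i\<in>UNIV. g i * u $ i) = 0" by (simp add: sum_distrib_left mult_ac)
    moreover have "((\<lambda>t. f (w + t *s u)) has_field_derivative (\<Sum>i\<in>UNIV. g i * u $ i)) (at 0)"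
      by (rule g[OF _ line_coord_derivative]) simp
    ultimately show ?thesis using \<open>c \<noteq> 0\<close> by simp
  qed
  then show ?thesis unfolding cone_tangent_space_def by blast
qed

section \<open>Pluecker coordinates\<close>

text \<open>The antisymmetric matrix of a bivector. The distinction of cases removes the order of the index type: on \<open>v \<and> w\<close> the entries are the usual \<open>2 \<times> 2\<close> minors for all pairs of indices (\<open>pl_wedge\<close>).\<close>

definition pl :: "'n::{finite, linorder} ext \<Rightarrow> 'n \<Rightarrow> 'n \<Rightarrow> complex" where
  "pl w i j = (if i < j then w $ {i, j} else if j < i then - w $ {i, j} else 0)"

text \<open>The inverse of \<open>pl\<close> on antisymmetric matrices.\<close>

definition of_pl :: "('n::{finite, linorder} \<Rightarrow> 'n \<Rightarrow> complex) \<Rightarrow> 'n ext" where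
  "of_pl p = (\<chi> S. if card S = 2 then p (Min S) (Max S) else 0)"

definition antisymm :: "('n \<Rightarrow> 'n \<Rightarrow> complex) \<Rightarrow> bool" where
  "antisymm p \<longleftrightarrow> (\<forall>i j. p i j = - p j i)"

lemma pl_swap: "pl w i j = - pl w j i"
  by (auto simp: pl_def insert_commute)

lemma antisymm_pl: "antisymm (pl w)"
  unfolding antisymm_def using pl_swap by blast

lemma pl_add: "pl (v + w) i j = pl v i j + pl w i j"
  and pl_scale: "pl (c *s w) i j = c * pl w i j"
  and pl_zero: "pl 0 i j = 0"
  by (auto simp: pl_def)

lemma hom_poly_pl: "hom_poly 1 (\<lambda>w. pl w i j)"
proof -
  have "pl w i j = (if i < j then 1 else if j < i then -1 else 0) * w $ {i, j}" for w :: "'a ext"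
    by (simp add: pl_def)
  then show ?thesis by (simp only: hom_poly_cmult[OF hom_poly_coord])
qed

lemma of_pl_in_ext_power: "of_pl p \<in> ext_power 2"
  by (simp add: of_pl_def ext_power_def)

lemma pl_of_pl:
  assumes "antisymm p"
  shows "pl (of_pl p) = p"
proof (intro ext)
  fix i j
  have swap: "p i j = - p j i" for i j using assms unfolding antisymm_def by blast
  have "p i i = 0" using swap[of i i] by simp
  moreover note swap[of i j]
  ultimately show "pl (of_pl p) i j = p i j"
    by (cases i j rule: linorder_cases) (auto simp: pl_def of_pl_def min_def max_def)
qed

lemma ext_power_2_eqI:
  assumes "v \<in> ext_power 2" "w \<in> ext_power 2" "\<And>i j. pl v i j = pl w i j"
  shows "v = w"
proof -
  have "v $ S = w $ S" for S
  proof (cases "card S = 2")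
    case True
    then obtain i j where S: "S = {i, j}" "i < j"
      by (metis card_2_iff insert_commute linorder_neqE)
    then show ?thesis using assms(3)[of i j] by (simp add: pl_def)
  next
    case False
    then show ?thesis using assms(1,2) by (simp add: ext_power_def)
  qed
  then show ?thesis by (simp add: vec_eq_iff)
qed

lemma subspace_ext_power: "vec.subspace (ext_power k)"
  by (auto simp: vec.subspace_def ext_power_def)

section \<open>Exterior products with vectors\<close>

lemma ext_of_vec_nth: "ext_of_vec v $ A = (\<Sum>i\<in>UNIV. if A = {i} then v $ i else 0)"
  unfolding ext_of_vec_def by (auto simp: axis_def if_distrib cong: if_cong intro!: sum.cong)

lemma ext_of_vec_nth_singleton [simp]: "ext_of_vec v $ {i} = v $ i"
  by (simp add: ext_of_vec_nth)

lemma ext_of_vec_nth_eq_0: "\<nexists>i. A = {i} \<Longrightarrow> ext_of_vec v $ A = 0"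
  by (auto simp: ext_of_vec_nth intro: sum.neutral)

lemma ext_of_vec_wedge_nth:
  "(ext_of_vec v \<and>\<^sub>E \<beta>) $ S = (\<Sum>i\<in>S. shuffle_sign {i} (S - {i}) * v $ i * \<beta> $ (S - {i}))"
proof -
  have "(ext_of_vec v \<and>\<^sub>E \<beta>) $ S =
      (\<Sum>A\<in>(\<lambda>i. {i}) ` S. shuffle_sign A (S - A) * ext_of_vec v $ A * \<beta> $ (S - A))"
    unfolding wedge_def vec_lambda_beta
    by (rule sum.mono_neutral_right) (auto intro!: ext_of_vec_nth_eq_0)
  also have "\<dots> = (\<Sum>i\<in>S. shuffle_sign {i} (S - {i}) * v $ i * \<beta> $ (S - {i}))"
    by (subst sum.reindex) auto
  finally show ?thesis .
qed

lemma shuffle_sign_empty [simp]: "shuffle_sign {i} {} = 1"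
  by (simp add: shuffle_sign_def)

lemma shuffle_sign_insert [simp]:
  fixes i :: "'n::{finite, linorder}"
  assumes "j \<notin> T"
  shows "shuffle_sign {i} (insert j T) = (if j < i then - 1 else 1) * shuffle_sign {i} T"
proof -
  have "{(a, b). a \<in> {i} \<and> b \<in> insert j T \<and> b < a} =
      (if j < i then insert (i, j) {(a, b). a \<in> {i} \<and> b \<in> T \<and> b < a} else {(a, b). a \<in> {i} \<and> b \<in> T \<and> b < a})"
    by auto
  then show ?thesis using assms by (simp add: shuffle_sign_def)
qed

lemma ext_of_vec_wedge_in_ext_power:
  assumes "\<beta> \<in> ext_power k"
  shows "ext_of_vec v \<and>\<^sub>E \<beta> \<in> ext_power (Suc k)"
proof -
  have "\<beta> $ (S - {i}) = 0" if "card S \<noteq> Suc k" "i \<in> S" for S i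
  proof -
    have "card S = Suc (card (S - {i}))" using that(2) by (intro card.remove) auto
    then show ?thesis using that(1) assms by (simp add: ext_power_def)
  qed
  then show ?thesis by (auto simp: ext_power_def ext_of_vec_wedge_nth intro!: sum.neutral)
qed

lemma ext_of_vec_in_ext_power: "ext_of_vec v \<in> ext_power 1"
  by (auto simp: ext_power_def card_1_singleton_iff intro!: ext_of_vec_nth_eq_0)

lemma wedge_ext_of_vec_in_ext_power: "ext_of_vec v \<and>\<^sub>E ext_of_vec w \<in> ext_power 2"
  using ext_of_vec_wedge_in_ext_power[OF ext_of_vec_in_ext_power] by (simp add: numeral_2_eq_2)

lemma pl_wedge: "pl (ext_of_vec v \<and>\<^sub>E ext_of_vec w) i j = v $ i * w $ j - v $ j * w $ i"
proof -
  have *: "(ext_of_vec v \<and>\<^sub>E ext_of_vec w) $ {i, j} = v $ i * w $ j - v $ j * w $ i" if "i < j" for i j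
  proof -
    have "{i, j} - {i} = {j}" "{i, j} - {j} = {i}" using that by auto
    then show ?thesis using that by (simp add: ext_of_vec_wedge_nth)
  qed
  show ?thesis
    using *[of i j] *[of j i]
    by (cases i j rule: linorder_cases) (simp_all add: pl_def insert_commute)
qed

section \<open>The seven linear equations\<close>

lemma UNIV_7: "UNIV = {1, 2, 3, 4, 5, 6, 7 :: 7}"
proof -
  have "card {1, 2, 3, 4, 5, 6, 7 :: 7} = CARD(7)" by simp
  then show ?thesis by (metis card_eq_UNIV_imp_eq_UNIV finite)
qed

lemma forall_7: "(\<forall>i::7. P i) \<longleftrightarrow> P 1 \<and> P 2 \<and> P 3 \<and> P 4 \<and> P 5 \<and> P 6 \<and> P 7"
  by (subst ball_UNIV[symmetric], subst UNIV_7) simp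

text \<open>In this type 7 is the least element.\<close>

lemma less_7:
  "(1::7) < 2" "(1::7) < 3" "(1::7) < 4" "(1::7) < 5" "(1::7) < 6"
  "(2::7) < 3" "(2::7) < 4" "(2::7) < 5" "(2::7) < 6" "(3::7) < 4" "(3::7) < 5" "(3::7) < 6"
  "(4::7) < 5" "(4::7) < 6" "(5::7) < 6"
  "(7::7) < 1" "(7::7) < 2" "(7::7) < 3" "(7::7) < 4" "(7::7) < 5" "(7::7) < 6"
  by (simp_all add: less_bit1_def bit1.Rep_numeral bit1.Rep_1)

lemmas order_7 = less_7 less_7[THEN less_not_sym]

lemma ext_of_vec_wedge_axis:
  "ext_of_vec v \<and>\<^sub>E axis T c = (\<Sum>i\<in>- T. axis (insert i T) (shuffle_sign {i} T * v $ i * c))"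
proof -
  have "(ext_of_vec v \<and>\<^sub>E axis T c) $ S = (\<Sum>i\<in>- T. axis (insert i T) (shuffle_sign {i} T * v $ i * c)) $ S" for S
  proof -
    have "(ext_of_vec v \<and>\<^sub>E axis T c) $ S =
        (\<Sum>i\<in>UNIV. if i \<in> S \<and> S - {i} = T then shuffle_sign {i} T * v $ i * c else 0)"
      unfolding ext_of_vec_wedge_nth
      by (rule sum.mono_neutral_cong_left) (auto simp: axis_def)
    also have "\<dots> = (\<Sum>i\<in>- T. if S = insert i T then shuffle_sign {i} T * v $ i * c else 0)"
      by (rule sum.mono_neutral_cong_right) auto
    finally show ?thesis by (simp add: axis_def)
  qed
  then show ?thesis by (simp add: vec_eq_iff)
qed

lemma wedge_add_right: "\<alpha> \<and>\<^sub>E (\<beta> + \<gamma>) = \<alpha> \<and>\<^sub>E \<beta> + \<alpha> \<and>\<^sub>E \<gamma>"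
  by (simp add: wedge_def vec_eq_iff distrib_left sum.distrib)

lemma xv_wedge_axis:
  assumes "i \<notin> T" shows "xv i \<and>\<^sub>E axis T c = axis (insert i T) (shuffle_sign {i} T * c)"
proof -
  have "xv i \<and>\<^sub>E axis T c = (\<Sum>j\<in>- T. if j = i then axis (insert i T) (shuffle_sign {i} T * c) else 0)"
    unfolding xv_def ext_of_vec_wedge_axis by (rule sum.cong) (auto simp: axis_def vec_eq_iff)
  then show ?thesis using assms by simp
qed

lemma xv_eq_axis: "xv i = axis {i} 1"
proof -
  have "ext_of_vec (axis i 1) = (\<Sum>j\<in>UNIV. if j = i then axis {i} 1 else 0)"
    unfolding ext_of_vec_def by (rule sum.cong) (auto simp: axis_def vec_eq_iff)
  then show ?thesis by (simp add: xv_def)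
qed

text \<open>The signs come from moving the factor \<open>x\<^sub>7\<close>, whose index is the least one, to the front past three others.\<close>

lemma omega0_eq: "\<omega>\<^sub>0 = axis {1, 2, 3, 7} (-1) + axis {4, 5, 6, 7} (-1) + axis {2, 3, 5, 6} 1 + axis {1, 3, 4, 6} 1"
proof -
  have "xv 5 \<and>\<^sub>E xv 6 = axis {5, 6} 1" "xv 4 \<and>\<^sub>E xv 6 = axis {4, 6} 1"
    by (simp_all add: xv_eq_axis[of 6] xv_wedge_axis order_7)
  moreover have "xv 3 \<and>\<^sub>E xv 7 = axis {3, 7} (-1)" "xv 6 \<and>\<^sub>E xv 7 = axis {6, 7} (-1)"
    by (simp_all add: xv_eq_axis[of 7] xv_wedge_axis order_7)
  ultimately show ?thesis
    unfolding \<omega>\<^sub>0_def by (simp add: xv_wedge_axis order_7)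
qed

lemma Compl_7:
  "- {1, 2, 3, 7} = ({4, 5, 6} :: 7 set)"
  "- {4, 5, 6, 7} = ({1, 2, 3} :: 7 set)"
  "- {2, 3, 5, 6} = ({1, 4, 7} :: 7 set)"
  "- {1, 3, 4, 6} = ({2, 5, 7} :: 7 set)"
  "- {4, 1, 2, 3, 7} = ({5, 6} :: 7 set)"
  "- {5, 1, 2, 3, 7} = ({4, 6} :: 7 set)"
  "- {6, 1, 2, 3, 7} = ({4, 5} :: 7 set)"
  "- {1, 4, 5, 6, 7} = ({2, 3} :: 7 set)"
  "- {2, 4, 5, 6, 7} = ({1, 3} :: 7 set)"
  "- {3, 4, 5, 6, 7} = ({1, 2} :: 7 set)"
  "- {1, 2, 3, 5, 6} = ({4, 7} :: 7 set)"
  "- {4, 2, 3, 5, 6} = ({1, 7} :: 7 set)"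
  "- {7, 2, 3, 5, 6} = ({1, 4} :: 7 set)"
  "- {2, 1, 3, 4, 6} = ({5, 7} :: 7 set)"
  "- {5, 1, 3, 4, 6} = ({2, 7} :: 7 set)"
  "- {7, 1, 3, 4, 6} = ({2, 5} :: 7 set)"
  by (simp_all add: set_eq_iff forall_7)

lemma six_element_sets_7:
  "{5, 4, 1, 2, 3, 7} = - {6 :: 7}"
  "{6, 4, 1, 2, 3, 7} = - {5 :: 7}"
  "{4, 5, 1, 2, 3, 7} = - {6 :: 7}"
  "{6, 5, 1, 2, 3, 7} = - {4 :: 7}"
  "{4, 6, 1, 2, 3, 7} = - {5 :: 7}"
  "{5, 6, 1, 2, 3, 7} = - {4 :: 7}"
  "{2, 1, 4, 5, 6, 7} = - {3 :: 7}"
  "{3, 1, 4, 5, 6, 7} = - {2 :: 7}"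
  "{1, 2, 4, 5, 6, 7} = - {3 :: 7}"
  "{3, 2, 4, 5, 6, 7} = - {1 :: 7}"
  "{1, 3, 4, 5, 6, 7} = - {2 :: 7}"
  "{2, 3, 4, 5, 6, 7} = - {1 :: 7}"
  "{4, 1, 2, 3, 5, 6} = - {7 :: 7}"
  "{7, 1, 2, 3, 5, 6} = - {4 :: 7}"
  "{1, 4, 2, 3, 5, 6} = - {7 :: 7}"
  "{7, 4, 2, 3, 5, 6} = - {1 :: 7}"
  "{1, 7, 2, 3, 5, 6} = - {4 :: 7}"
  "{4, 7, 2, 3, 5, 6} = - {1 :: 7}"
  "{5, 2, 1, 3, 4, 6} = - {7 :: 7}"
  "{7, 2, 1, 3, 4, 6} = - {5 :: 7}"
  "{2, 5, 1, 3, 4, 6} = - {7 :: 7}"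
  "{7, 5, 1, 3, 4, 6} = - {2 :: 7}"
  "{2, 7, 1, 3, 4, 6} = - {5 :: 7}"
  "{5, 7, 1, 3, 4, 6} = - {2 :: 7}"
  by (simp_all add: set_eq_iff forall_7)

definition omega_relations :: "(7 \<Rightarrow> 7 \<Rightarrow> complex) \<Rightarrow> bool" where
  "omega_relations p \<longleftrightarrow> p 1 2 = 0 \<and> p 4 5 = 0 \<and> p 1 4 = - p 2 5 \<and> p 1 3 = p 5 7 \<and> p 2 3 = - p 4 7
     \<and> p 4 6 = p 2 7 \<and> p 5 6 = - p 1 7"

text \<open>The product \<open>v \<and> w \<and> \<omega>\<^sub>0\<close> lies in \<open>\<And>\<^sup>6V\<close>, whose seven basis vectors are indexed by the complements of the single indices. Each coordinate involves only those \<open>p\<^sub>i\<^sub>j\<close> whose indices avoid the four indices of some term of \<open>\<omega>\<^sub>0\<close>.\<close>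

lemma wedge_omega0_eq_0_iff:
  "ext_of_vec v \<and>\<^sub>E ext_of_vec w \<and>\<^sub>E \<omega>\<^sub>0 = 0 \<longleftrightarrow> omega_relations (\<lambda>i j. v $ i * w $ j - v $ j * w $ i)"
proof -
  let ?\<alpha> = "ext_of_vec v \<and>\<^sub>E ext_of_vec w \<and>\<^sub>E \<omega>\<^sub>0"
  have \<alpha>: "?\<alpha> =
      axis (- {1}) (- (v $ 2 * w $ 3 - v $ 3 * w $ 2) - (v $ 4 * w $ 7 - v $ 7 * w $ 4)) +
      axis (- {2}) (- (v $ 1 * w $ 3 - v $ 3 * w $ 1) + (v $ 5 * w $ 7 - v $ 7 * w $ 5)) +
      axis (- {3}) (- (v $ 1 * w $ 2 - v $ 2 * w $ 1)) +
      axis (- {4}) (- (v $ 5 * w $ 6 - v $ 6 * w $ 5) - (v $ 1 * w $ 7 - v $ 7 * w $ 1)) +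
      axis (- {5}) (- (v $ 4 * w $ 6 - v $ 6 * w $ 4) + (v $ 2 * w $ 7 - v $ 7 * w $ 2)) +
      axis (- {6}) (- (v $ 4 * w $ 5 - v $ 5 * w $ 4)) +
      axis (- {7}) ((v $ 1 * w $ 4 - v $ 4 * w $ 1) + (v $ 2 * w $ 5 - v $ 5 * w $ 2))"
    by (simp add: omega0_eq wedge_add_right ext_of_vec_wedge_axis Compl_7 order_7)
      (simp only: six_element_sets_7, simp add: vec_eq_iff axis_def algebra_simps)
  have axis0: "axis k 0 = (0 :: 7 ext)" for k by (simp add: axis_def vec_eq_iff)
  show ?thesis
  proof
    assume "?\<alpha> = 0"
    then have "\<forall>k. ?\<alpha> $ (- {k}) = 0" by simp
    then show "omega_relations (\<lambda>i j. v $ i * w $ j - v $ j * w $ i)"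
      unfolding \<alpha> forall_7 omega_relations_def by (simp add: axis_def algebra_simps)
  next
    assume "omega_relations (\<lambda>i j. v $ i * w $ j - v $ j * w $ i)"
    then show "?\<alpha> = 0"
      unfolding \<alpha> omega_relations_def by (simp add: axis0)
  qed
qed


section \<open>The affine cone\<close>

definition plucker :: "('n \<Rightarrow> 'n \<Rightarrow> complex) \<Rightarrow> bool" where
  "plucker p \<longleftrightarrow> (\<forall>i j k l. p i j * p k l - p i k * p j l + p i l * p j k = 0)"

definition cone_relations :: "(7 \<Rightarrow> 7 \<Rightarrow> complex) \<Rightarrow> bool" where
  "cone_relations p \<longleftrightarrow> antisymm p \<and> plucker p \<and> omega_relations p"

definition cone :: "7 ext set" where
  "cone = {w \<in> ext_power 2. cone_relations (pl w)}"

lemma cone_relations_swap: "cone_relations p \<Longrightarrow> p i j = - p j i"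
  unfolding cone_relations_def antisymm_def by blast

lemma cone_relations_plucker: "cone_relations p \<Longrightarrow> p i j * p k l - p i k * p j l + p i l * p j k = 0"
  unfolding cone_relations_def plucker_def by blast

text \<open>The quadratic relation for the indices \<open>a, b, i, j\<close>, solved for \<open>p i j\<close>: a bivector satisfying the relations is the product of its rows \<open>a\<close> and \<open>b\<close>, up to the factor \<open>p a b\<close>.\<close>

lemma cone_relations_decomposable:
  assumes "cone_relations p" "p a b \<noteq> 0"
  shows "p i j = (p a i * p b j - p a j * p b i) / p a b"
proof -
  have "p a b * p i j = p a i * p b j - p a j * p b i"
    using cone_relations_plucker[OF assms(1), of a b i j] by (simp add: algebra_simps)
  then show ?thesis using assms(2) by (simp add: field_simps)
qed

lemma cone_relations_scale: "cone_relations p \<Longrightarrow> cone_relations (\<lambda>i j. c * p i j)"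
proof -
  assume p: "cone_relations p"
  have "c * p i j = - (c * p j i)" for i j using cone_relations_swap[OF p, of i j] by simp
  moreover have "c * p i j * (c * p k l) - c * p i k * (c * p j l) + c * p i l * (c * p j k) = 0" for i j k l
  proof -
    have "c * p i j * (c * p k l) - c * p i k * (c * p j l) + c * p i l * (c * p j k) =
        c * c * (p i j * p k l - p i k * p j l + p i l * p j k)" by (simp add: algebra_simps)
    then show ?thesis using cone_relations_plucker[OF p, of i j k l] by simp
  qed
  moreover have "omega_relations (\<lambda>i j. c * p i j)" using p by (simp add: cone_relations_def omega_relations_def)
  ultimately show ?thesis unfolding cone_relations_def antisymm_def plucker_def by blast
qed

lemma cone_scale: "w \<in> cone \<Longrightarrow> c *s w \<in> cone"
  using cone_relations_scale[of "pl w" c] vec.subspace_scale[OF subspace_ext_power, of w 2 c]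
  by (simp add: cone_def pl_scale[abs_def])

definition bivec :: "('n \<Rightarrow> complex) \<Rightarrow> ('n \<Rightarrow> complex) \<Rightarrow> 'n \<Rightarrow> 'n \<Rightarrow> complex" where
  "bivec v w i j = v i * w j - v j * w i"

lemma cone_relations_bivec_iff: "cone_relations (bivec v w) \<longleftrightarrow> omega_relations (bivec v w)"
  unfolding cone_relations_def antisymm_def plucker_def bivec_def by (auto simp: algebra_simps)

lemma pl_wedge': "pl (ext_of_vec v \<and>\<^sub>E ext_of_vec w) = bivec (($) v) (($) w)"
  by (simp add: pl_wedge bivec_def fun_eq_iff)

text \<open>A nonzero point of the cone has a nonzero coordinate, and the quadratic relations then exhibit the point as a multiple of the product of two rows of its matrix.\<close>

lemma G2_hat_iff: "L \<in> G2_hat \<longleftrightarrow> (\<exists>w\<in>cone. w \<noteq> 0 \<and> L = vec.span {w})"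
proof
  assume L: "L \<in> G2_hat"
  then obtain v w where vw: "L = vec.span {ext_of_vec v \<and>\<^sub>E ext_of_vec w}"
      "ext_of_vec v \<and>\<^sub>E ext_of_vec w \<and>\<^sub>E \<omega>\<^sub>0 = 0"
    unfolding G2_hat_def by blast
  have "vec.dim L = 1" using L by (simp add: G2_hat_def G2V_def proj_space_def)
  then have "ext_of_vec v \<and>\<^sub>E ext_of_vec w \<noteq> 0" using vw(1) by auto
  moreover have "ext_of_vec v \<and>\<^sub>E ext_of_vec w \<in> cone"
    using vw(2) unfolding cone_def wedge_omega0_eq_0_iff
    by (simp add: wedge_ext_of_vec_in_ext_power pl_wedge' cone_relations_bivec_iff) (simp add: bivec_def omega_relations_def)
  ultimately show "\<exists>w\<in>cone. w \<noteq> 0 \<and> L = vec.span {w}" using vw(1) by blast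
next
  assume "\<exists>w\<in>cone. w \<noteq> 0 \<and> L = vec.span {w}"
  then obtain w where w: "w \<in> cone" "w \<noteq> 0" "L = vec.span {w}" by blast
  have cone_relations: "cone_relations (pl w)" and w2: "w \<in> ext_power 2" using w(1) by (auto simp: cone_def)
  obtain a b where ab: "pl w a b \<noteq> 0"
    using ext_power_2_eqI[OF w2 vec.subspace_0[OF subspace_ext_power]] w(2) by (auto simp: pl_zero)
  define v\<^sub>1 where "v\<^sub>1 = (\<chi> i. pl w a i / pl w a b)"
  define v\<^sub>2 where "v\<^sub>2 = (\<chi> i. pl w b i)"
  have weq: "w = ext_of_vec v\<^sub>1 \<and>\<^sub>E ext_of_vec v\<^sub>2"
    by (rule ext_power_2_eqI[OF w2 wedge_ext_of_vec_in_ext_power], subst cone_relations_decomposable[OF cone_relations ab])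
      (simp add: pl_wedge v\<^sub>1_def v\<^sub>2_def diff_divide_distrib)
  have "omega_relations (bivec (($) v\<^sub>1) (($) v\<^sub>2))"
    using cone_relations unfolding cone_relations_def weq pl_wedge' by blast
  then have "ext_of_vec v\<^sub>1 \<and>\<^sub>E ext_of_vec v\<^sub>2 \<and>\<^sub>E \<omega>\<^sub>0 = 0"
    unfolding wedge_omega0_eq_0_iff by (simp add: bivec_def omega_relations_def)
  moreover have "L \<in> proj_space (ext_power 2)"
    using span_singleton_in_proj_space[OF w(2) subspace_ext_power w2] w(3) by simp
  ultimately show "L \<in> G2_hat"
    unfolding G2_hat_def G2V_def using w(3) weq by blast
qed

text \<open>Besides the quadratic and the linear relations, the coordinates outside \<open>\<And>\<^sup>2V\<close> have to be included among the equations, since the ambient space is the whole exterior algebra.\<close>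

lemma zariski_closed_G2_hat: "zariski_closed G2_hat"
proof -
  define F :: "(7 ext \<Rightarrow> complex) set" where
    "F = (\<lambda>S w. w $ S) ` {S. card S \<noteq> 2}
      \<union> range (\<lambda>(i, j, k, l) w. pl w i j * pl w k l - pl w i k * pl w j l + pl w i l * pl w j k)
      \<union> {\<lambda>w. pl w 1 2, \<lambda>w. pl w 4 5, \<lambda>w. pl w 1 4 + pl w 2 5, \<lambda>w. pl w 1 3 - pl w 5 7,
          \<lambda>w. pl w 2 3 + pl w 4 7, \<lambda>w. pl w 4 6 - pl w 2 7, \<lambda>w. pl w 5 6 + pl w 1 7}"
  have quad: "hom_poly 2 (\<lambda>w. pl w i j * pl w k l)" for i j k l :: 7
    using hom_poly_mult[OF hom_poly_pl hom_poly_pl] by (simp add: numeral_2_eq_2)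
  have F: "\<exists>d. hom_poly d f" if "f \<in> F" for f
    using that unfolding F_def
    by (auto intro: hom_poly_coord hom_poly_pl quad hom_poly_add[OF hom_poly_pl hom_poly_pl]
        hom_poly_diff[OF hom_poly_pl hom_poly_pl] hom_poly_add[OF hom_poly_diff[OF quad quad] quad])
  have "w \<in> cone \<longleftrightarrow> (\<forall>f\<in>F. f w = 0)" for w
    unfolding cone_def cone_relations_def plucker_def omega_relations_def F_def
    by (simp add: antisymm_pl ext_power_def eq_neg_iff_add_eq_0 ball_Un split_paired_All) blast
  then have "L \<in> G2_hat \<longleftrightarrow> L \<in> proj_space UNIV \<and> (\<forall>f\<in>F. vanishes_on f {L})" for L
    unfolding G2_hat_iff proj_space_iff using F vanishes_on_span_singleton by (auto, blast+)
  then show ?thesis unfolding zariski_closed_def using F by blast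
qed

section \<open>Equations of the tangent spaces\<close>

text \<open>The polarised quadratic relations: \<open>u\<close> lies in the kernel of their differentials at \<open>p\<close>.\<close>

definition plucker_differential :: "('n \<Rightarrow> 'n \<Rightarrow> complex) \<Rightarrow> ('n \<Rightarrow> 'n \<Rightarrow> complex) \<Rightarrow> bool" where
  "plucker_differential p u \<longleftrightarrow> (\<forall>i j k l. (u i j * p k l + p i j * u k l)
     - (u i k * p j l + p i k * u j l) + (u i l * p j k + p i l * u j k) = 0)"

lemma line_pl_derivative:
  "((\<lambda>t. pl (w + t *s u) i j) has_field_derivative pl u i j) (at 0)"
  unfolding pl_add pl_scale by (auto intro!: derivative_eq_intros)

text \<open>Each equation of the cone is differentiated along the line \<open>w + t u\<close>.\<close>

lemma cone_tangent_space_G2_hat: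
  assumes w: "w \<noteq> 0" and u: "u \<in> cone_tangent_space G2_hat (vec.span {w})"
  shows "u \<in> ext_power 2" "omega_relations (pl u)" "plucker_differential (pl w) (pl u)"
proof -
  have wL: "w \<in> vec.span {w} - {0}" using w by (simp add: vec.span_base)
  have van: "vanishes_on f G2_hat" if "hom_poly d f" "\<And>v. v \<in> cone \<Longrightarrow> f v = 0" for d f
    using that cone_scale by (auto simp: vanishes_on_def G2_hat_iff vec.span_singleton)
  have D: "D = 0" if "hom_poly d f" "\<And>v. v \<in> cone \<Longrightarrow> f v = 0"
      "((\<lambda>t. f (w + t *s u)) has_field_derivative D) (at 0)" for d f D
    using u wL van[OF that(1,2)] that(1,3) DERIV_unique unfolding cone_tangent_space_def by blast
  have "u $ S = 0" if "card S \<noteq> 2" for S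
    by (rule D[OF hom_poly_coord _ line_coord_derivative])
      (use that in \<open>simp add: cone_def ext_power_def\<close>)
  then show "u \<in> ext_power 2" by (simp add: ext_power_def)
  have relc: "cone_relations (pl v)" if "v \<in> cone" for v using that by (simp add: cone_def)
  have add: "pl u i j + pl u k l = 0" if "\<And>v. v \<in> cone \<Longrightarrow> pl v i j + pl v k l = 0" for i j k l
    by (rule D[OF hom_poly_add[OF hom_poly_pl hom_poly_pl] that DERIV_add[OF line_pl_derivative line_pl_derivative]])
  have diff: "pl u i j - pl u k l = 0" if "\<And>v. v \<in> cone \<Longrightarrow> pl v i j - pl v k l = 0" for i j k l
    by (rule D[OF hom_poly_diff[OF hom_poly_pl hom_poly_pl] that DERIV_diff[OF line_pl_derivative line_pl_derivative]])
  have single: "pl u i j = 0" if "\<And>v. v \<in> cone \<Longrightarrow> pl v i j = 0" for i j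
    by (rule D[OF hom_poly_pl that line_pl_derivative])
  have "pl u 1 2 = 0" "pl u 4 5 = 0" "pl u 1 4 + pl u 2 5 = 0" "pl u 1 3 - pl u 5 7 = 0"
    "pl u 2 3 + pl u 4 7 = 0" "pl u 4 6 - pl u 2 7 = 0" "pl u 5 6 + pl u 1 7 = 0"
    by (rule single add diff; use relc in \<open>simp add: cone_relations_def omega_relations_def\<close>)+
  then show "omega_relations (pl u)" by (simp add: omega_relations_def eq_neg_iff_add_eq_0)
  have quad: "hom_poly 2 (\<lambda>w. pl w i j * pl w k l)" for i j k l :: 7
    using hom_poly_mult[OF hom_poly_pl hom_poly_pl] by (simp add: numeral_2_eq_2)
  have dquad: "((\<lambda>t. pl (w + t *s u) i j * pl (w + t *s u) k l) has_field_derivative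
      pl u i j * pl w k l + pl w i j * pl u k l) (at 0)" for i j k l
    using DERIV_mult[OF line_pl_derivative[of w u i j] line_pl_derivative[of w u k l]]
    by (simp add: mult.commute)
  have "(pl u i j * pl w k l + pl w i j * pl u k l) - (pl u i k * pl w j l + pl w i k * pl u j l)
      + (pl u i l * pl w j k + pl w i l * pl u j k) = 0" for i j k l
    by (rule D[OF hom_poly_add[OF hom_poly_diff[OF quad quad] quad] cone_relations_plucker[OF relc]
          DERIV_add[OF DERIV_diff[OF dquad dquad] dquad]])
  then show "plucker_differential (pl w) (pl u)" by (simp add: plucker_differential_def)
qed

section \<open>Signed permutations of the basis\<close>

definition twist :: "('n \<Rightarrow> complex) \<Rightarrow> ('n \<Rightarrow> 'n) \<Rightarrow> ('n \<Rightarrow> 'n \<Rightarrow> complex) \<Rightarrow> 'n \<Rightarrow> 'n \<Rightarrow> complex" where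
  "twist \<epsilon> \<sigma> p i j = \<epsilon> i * \<epsilon> j * p (\<sigma> i) (\<sigma> j)"

text \<open>Involutive signed permutations of the basis that preserve the linear relations. The quadratic relations are preserved by every signed permutation (\<open>twist_plucker_differential\<close>).\<close>

definition symmetry :: "(7 \<Rightarrow> complex) \<Rightarrow> (7 \<Rightarrow> 7) \<Rightarrow> bool" where
  "symmetry \<epsilon> \<sigma> \<longleftrightarrow> (\<forall>i. \<sigma> (\<sigma> i) = i \<and> \<epsilon> i * \<epsilon> (\<sigma> i) = 1) \<and>
     (\<forall>p. antisymm p \<and> omega_relations p \<longrightarrow> omega_relations (twist \<epsilon> \<sigma> p))"

lemma antisymm_twist: "antisymm p \<Longrightarrow> antisymm (twist \<epsilon> \<sigma> p)"
proof -
  assume "antisymm p"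
  then have "p (\<sigma> i) (\<sigma> j) = - p (\<sigma> j) (\<sigma> i)" for i j unfolding antisymm_def by blast
  then have "twist \<epsilon> \<sigma> p i j = - twist \<epsilon> \<sigma> p j i" for i j
    unfolding twist_def by (metis mult.commute mult_minus_right)
  then show ?thesis unfolding antisymm_def by blast
qed

lemma twist_twist:
  assumes "symmetry \<epsilon> \<sigma>" shows "twist \<epsilon> \<sigma> (twist \<epsilon> \<sigma> p) = p"
proof (intro ext)
  fix i j
  have \<sigma>: "\<sigma> (\<sigma> i) = i" "\<epsilon> i * \<epsilon> (\<sigma> i) = 1" for i using assms unfolding symmetry_def by auto
  have "twist \<epsilon> \<sigma> (twist \<epsilon> \<sigma> p) i j = (\<epsilon> i * \<epsilon> (\<sigma> i)) * (\<epsilon> j * \<epsilon> (\<sigma> j)) * p i j"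
    unfolding twist_def \<sigma>(1) by (simp only: mult_ac)
  then show "twist \<epsilon> \<sigma> (twist \<epsilon> \<sigma> p) i j = p i j" unfolding \<sigma>(2) by simp
qed

lemma twist_plucker_differential:
  assumes "plucker_differential p u"
  shows "plucker_differential (twist \<epsilon> \<sigma> p) (twist \<epsilon> \<sigma> u)"
proof -
  have "(twist \<epsilon> \<sigma> u i j * twist \<epsilon> \<sigma> p k l + twist \<epsilon> \<sigma> p i j * twist \<epsilon> \<sigma> u k l)
     - (twist \<epsilon> \<sigma> u i k * twist \<epsilon> \<sigma> p j l + twist \<epsilon> \<sigma> p i k * twist \<epsilon> \<sigma> u j l)
     + (twist \<epsilon> \<sigma> u i l * twist \<epsilon> \<sigma> p j k + twist \<epsilon> \<sigma> p i l * twist \<epsilon> \<sigma> u j k) =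
     \<epsilon> i * \<epsilon> j * \<epsilon> k * \<epsilon> l * ((u (\<sigma> i) (\<sigma> j) * p (\<sigma> k) (\<sigma> l) + p (\<sigma> i) (\<sigma> j) * u (\<sigma> k) (\<sigma> l))
     - (u (\<sigma> i) (\<sigma> k) * p (\<sigma> j) (\<sigma> l) + p (\<sigma> i) (\<sigma> k) * u (\<sigma> j) (\<sigma> l))
     + (u (\<sigma> i) (\<sigma> l) * p (\<sigma> j) (\<sigma> k) + p (\<sigma> i) (\<sigma> l) * u (\<sigma> j) (\<sigma> k)))" for i j k l
    unfolding twist_def by algebra
  then show ?thesis using assms unfolding plucker_differential_def by simp
qed

text \<open>Quadratic relations are half of their polarisation on the diagonal. This lets one computation serve for a point and for its tangent vectors.\<close>

lemma plucker_iff_differential: "plucker p \<longleftrightarrow> plucker_differential p p"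
proof -
  have "(p i j * p k l + p i j * p k l) - (p i k * p j l + p i k * p j l) + (p i l * p j k + p i l * p j k)
      = 2 * (p i j * p k l - p i k * p j l + p i l * p j k)" for i j k l
    by simp
  then show ?thesis unfolding plucker_def plucker_differential_def by (simp del: distrib_left_numeral right_diff_distrib_numeral)
qed

lemma cone_relations_twist: "symmetry \<epsilon> \<sigma> \<Longrightarrow> cone_relations p \<Longrightarrow> cone_relations (twist \<epsilon> \<sigma> p)"
  unfolding cone_relations_def plucker_iff_differential
  using antisymm_twist twist_plucker_differential by (auto simp: symmetry_def)

section \<open>Affine charts\<close>

text \<open>Data of a chart where the coordinate \<open>p a b\<close> is nonzero, normalised to 1: the five coordinates listed by \<open>idx\<close> are free parameters, and the rows \<open>a\<close> and \<open>b\<close> of the matrix, which determine all of it, are the polynomial functions \<open>r\<close> and \<open>s\<close> of these parameters. The assumption \<open>tangent\<close> is the infinitesimal version of \<open>graph\<close>. The results below are about coordinates twisted by a symmetry, so that one chart serves for its images under the symmetries as well.\<close>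

locale chart =
  fixes a b :: 7 and idx :: "nat \<Rightarrow> 7 \<times> 7" and r s :: "(nat \<Rightarrow> complex) \<Rightarrow> 7 \<Rightarrow> complex"
  assumes lin: "omega_relations (bivec (r t) (s t))"
    and ab: "bivec (r t) (s t) a b = 1"
    and idx: "k < 5 \<Longrightarrow> bivec (r t) (s t) (fst (idx k)) (snd (idx k)) = t k"
    and line_poly: "line_poly (\<lambda>t. r t i)" "line_poly (\<lambda>t. s t i)"
    and graph: "cone_relations p \<Longrightarrow> p a b = 1 \<Longrightarrow> (\<And>k. k < 5 \<Longrightarrow> t k = p (fst (idx k)) (snd (idx k))) \<Longrightarrow>
      p a i = r t i \<and> p b i = s t i"
    and tangent: "cone_relations p \<Longrightarrow> p a b \<noteq> 0 \<Longrightarrow> antisymm u \<Longrightarrow> omega_relations u \<Longrightarrow> plucker_differential p u \<Longrightarrow>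
      u a b = 0 \<Longrightarrow> (\<And>k. k < 5 \<Longrightarrow> u (fst (idx k)) (snd (idx k)) = 0) \<Longrightarrow> u a i = 0 \<and> u b i = 0"
begin

definition \<psi> :: "(7 \<Rightarrow> complex) \<Rightarrow> (7 \<Rightarrow> 7) \<Rightarrow> (nat \<Rightarrow> complex) \<Rightarrow> 7 ext" where
  "\<psi> \<epsilon> \<sigma> t = of_pl (twist \<epsilon> \<sigma> (bivec (r t) (s t)))"

context
  fixes \<epsilon> \<sigma> assumes sym: "symmetry \<epsilon> \<sigma>"
begin

lemma cone_relations_bivec_rows: "cone_relations (bivec (r t) (s t))"
  using lin cone_relations_bivec_iff by blast

lemma pl_\<psi>: "pl (\<psi> \<epsilon> \<sigma> t) = twist \<epsilon> \<sigma> (bivec (r t) (s t))"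
  unfolding \<psi>_def using cone_relations_twist[OF sym cone_relations_bivec_rows] pl_of_pl cone_relations_def by blast

lemma \<psi>_in_cone: "\<psi> \<epsilon> \<sigma> t \<in> cone"
  unfolding cone_def
  using cone_relations_twist[OF sym cone_relations_bivec_rows] pl_\<psi> of_pl_in_ext_power \<psi>_def by simp

lemma twist_pl_\<psi>: "twist \<epsilon> \<sigma> (pl (\<psi> \<epsilon> \<sigma> t)) = bivec (r t) (s t)"
  unfolding pl_\<psi> by (rule twist_twist[OF sym])

lemma line_poly_\<psi>: "line_poly (\<lambda>t. \<psi> \<epsilon> \<sigma> t $ S)"
proof (cases "card S = 2")
  case True
  then show ?thesis
    unfolding \<psi>_def of_pl_def twist_def bivec_def
    by (simp add: line_poly_mult line_poly_diff line_poly_const line_poly)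
next
  case False
  then show ?thesis by (simp add: \<psi>_def of_pl_def line_poly_const)
qed

lemma chart_point:
  assumes "w \<in> cone" "twist \<epsilon> \<sigma> (pl w) a b \<noteq> 0"
  obtains t where "w = twist \<epsilon> \<sigma> (pl w) a b *s \<psi> \<epsilon> \<sigma> t"
proof -
  let ?q = "twist \<epsilon> \<sigma> (pl w)"
  let ?p = "\<lambda>i j. inverse (?q a b) * ?q i j"
  let ?t = "\<lambda>k. ?p (fst (idx k)) (snd (idx k))"
  have relp: "cone_relations ?p"
    using assms(1) cone_relations_scale[OF cone_relations_twist[OF sym]] by (simp add: cone_def)
  have p1: "?p a b = 1" using assms(2) by simp
  have rows: "?p a i = r ?t i \<and> ?p b i = s ?t i" for i
    by (rule graph[OF relp p1]) simp
  have "?p i j = bivec (r ?t) (s ?t) i j" for i j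
  proof -
    have "?p i j = (?p a i * ?p b j - ?p a j * ?p b i) / ?p a b"
      by (rule cone_relations_decomposable[OF relp]) (use p1 in simp)
    also have "\<dots> = bivec (r ?t) (s ?t) i j"
      unfolding p1 bivec_def using rows[of i] rows[of j] by simp
    finally show ?thesis .
  qed
  then have "?p = bivec (r ?t) (s ?t)" by (intro ext)
  then have "pl (\<psi> \<epsilon> \<sigma> ?t) = twist \<epsilon> \<sigma> ?p" unfolding pl_\<psi> by simp
  also have "\<dots> = (\<lambda>i j. inverse (?q a b) * twist \<epsilon> \<sigma> ?q i j)"
    by (simp add: twist_def fun_eq_iff)
  also have "\<dots> = (\<lambda>i j. inverse (?q a b) * pl w i j)" unfolding twist_twist[OF sym] ..
  finally have "pl w i j = ?q a b * pl (\<psi> \<epsilon> \<sigma> ?t) i j" for i j using assms(2) by simp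
  then have "w = ?q a b *s \<psi> \<epsilon> \<sigma> ?t"
    using assms(1) \<psi>_in_cone[of ?t] cone_scale
    by (intro ext_power_2_eqI) (auto simp: cone_def pl_scale)
  then show ?thesis by (rule that)
qed

lemma hom_poly_twist_pl: "hom_poly 1 (\<lambda>w. twist \<epsilon> \<sigma> (pl w) i j)"
  unfolding twist_def by (intro hom_poly_cmult hom_poly_pl)

lemma \<psi>_nonzero: "\<psi> \<epsilon> \<sigma> t \<noteq> 0"
proof
  assume "\<psi> \<epsilon> \<sigma> t = 0"
  then have "twist \<epsilon> \<sigma> (pl (\<psi> \<epsilon> \<sigma> t)) a b = 0" by (simp add: twist_def pl_zero)
  then show False unfolding twist_pl_\<psi> ab by simp
qed

lemma local_dim_ge_5:
  assumes "w \<in> cone" "twist \<epsilon> \<sigma> (pl w) a b \<noteq> 0"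
  shows "5 \<le> local_dim G2_hat (vec.span {w})"
proof -
  obtain t where t: "w = twist \<epsilon> \<sigma> (pl w) a b *s \<psi> \<epsilon> \<sigma> t" by (rule chart_point[OF assms])
  have "vec.span {w} = vec.span {\<psi> \<epsilon> \<sigma> t}"
    by (subst t) (rule span_singleton_scale[OF assms(2)])
  moreover have "enat 5 \<le> local_dim G2_hat (vec.span {\<psi> \<epsilon> \<sigma> t})"
  proof (rule local_dim_ge_of_chart[OF zariski_closed_G2_hat line_poly_\<psi>])
    show "vec.span {\<psi> \<epsilon> \<sigma> t} \<in> G2_hat" for t
      using \<psi>_in_cone \<psi>_nonzero G2_hat_iff by blast
    show "hom_poly 1 (\<lambda>w. twist \<epsilon> \<sigma> (pl w) a b)" by (rule hom_poly_twist_pl)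
    show "twist \<epsilon> \<sigma> (pl (\<psi> \<epsilon> \<sigma> t)) a b = 1" for t unfolding twist_pl_\<psi> by (rule ab)
    show "hom_poly 1 (\<lambda>w. twist \<epsilon> \<sigma> (pl w) (fst (idx k)) (snd (idx k)))" for k
      by (rule hom_poly_twist_pl)
    show "twist \<epsilon> \<sigma> (pl (\<psi> \<epsilon> \<sigma> t)) (fst (idx k)) (snd (idx k)) = t k" if "k < 5" for k t
      unfolding twist_pl_\<psi> by (rule idx[OF that])
  qed
  ultimately show ?thesis by (simp add: numeral_eq_enat)
qed

text \<open>The six coordinates \<open>p a b\<close> and \<open>p (idx k)\<close> embed the tangent space into \<open>\<complex>\<^sup>6\<close>.\<close>

lemma dim_cone_tangent_space_le_6:
  assumes w: "w \<in> cone" "twist \<epsilon> \<sigma> (pl w) a b \<noteq> 0"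
  shows "vec.dim (cone_tangent_space G2_hat (vec.span {w})) \<le> 6"
proof -
  let ?T = "cone_tangent_space G2_hat (vec.span {w})"
  let ?q = "\<lambda>u. twist \<epsilon> \<sigma> (pl u)"
  have w0: "w \<noteq> 0" using w(2) by (auto simp: twist_def pl_zero)
  obtain h :: "6 \<Rightarrow> nat" where h: "bij_betw h UNIV {..<6}"
    using ex_bij_betw_finite_nat[of "UNIV :: 6 set"] by (auto simp: atLeast0LessThan)
  define l where "l k u = (case k of 0 \<Rightarrow> ?q u a b | Suc k \<Rightarrow> ?q u (fst (idx k)) (snd (idx k)))" for k u
  define \<pi> where "\<pi> u = (\<chi> k. l (h k) u)" for u
  have "Vector_Spaces.linear (*s) (*s) \<pi>"
    unfolding Vector_Spaces.linear_iff \<pi>_def l_def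
    by (auto simp: vec.vector_space_axioms vec_eq_iff twist_def pl_add pl_scale algebra_simps split: nat.split)
  moreover have inj: "inj_on \<pi> (vec.span ?T)"
  proof (rule inj_onI)
    fix x y assume xy: "x \<in> vec.span ?T" "y \<in> vec.span ?T" "\<pi> x = \<pi> y"
    let ?u = "x - y"
    have "vec.span ?T = ?T" using subspace_cone_tangent_space by (rule vec.span_eq_iff[THEN iffD2])
    then have u: "?u \<in> ?T" using xy(1,2) vec.subspace_diff[OF subspace_cone_tangent_space] by metis
    note T = cone_tangent_space_G2_hat[OF w0 u]
    have "l (h k) x = l (h k) y" for k using xy(3) by (simp add: \<pi>_def vec_eq_iff)
    then have lxy: "l k x = l k y" if "k < 6" for k
      using h that unfolding bij_betw_def by (metis imageE lessThan_iff)
    have qdiff: "?q ?u i j = ?q x i j - ?q y i j" for i j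
      using pl_add[of "x - y" y i] by (simp add: twist_def) (metis add_diff_cancel_right' diff_add_cancel pl_add right_diff_distrib)
    have 0: "?q ?u a b = 0" using lxy[of 0] by (simp add: qdiff l_def)
    have k: "?q ?u (fst (idx k)) (snd (idx k)) = 0" if "k < 5" for k
      using lxy[of "Suc k"] that by (simp add: qdiff l_def)
    have rq: "cone_relations (?q w)" using w(1) cone_relations_twist[OF sym] by (simp add: cone_def)
    have pd: "plucker_differential (?q w) (?q ?u)" by (rule twist_plucker_differential[OF T(3)])
    have rows: "?q ?u a i = 0 \<and> ?q ?u b i = 0" for i
      by (rule tangent[OF rq w(2) antisymm_twist[OF antisymm_pl] _ pd 0 k])
        (use sym T(2) antisymm_pl in \<open>auto simp: symmetry_def\<close>)
    have "?q ?u i j = 0" for i j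
      using pd[unfolded plucker_differential_def, rule_format, of a b i j] w(2) rows 0 by simp
    then have "twist \<epsilon> \<sigma> (?q ?u) i j = 0" for i j unfolding twist_def[of _ _ "?q ?u"] by simp
    then have "pl ?u i j = 0" for i j unfolding twist_twist[OF sym] .
    then have "?u = 0"
      by (intro ext_power_2_eqI T(1) vec.subspace_0[OF subspace_ext_power]) (simp add: pl_zero)
    then show "x = y" by simp
  qed
  ultimately have "vec.dim ?T = vec.dim (\<pi> ` ?T)" by (simp add: vec.dim_image_eq)
  also have "\<dots> \<le> CARD(6)" by (rule dim_subset_UNIV_cart_gen)
  finally show ?thesis by simp
qed

text \<open>The cone is irreducible along a chart: if \<open>g\<close> is nonzero at a single point of the chart, it can be cancelled.\<close>

lemma chart_irreducible:
  assumes f: "hom_poly d f" "hom_poly e g" "\<And>w. w \<in> cone \<Longrightarrow> f w * g w = 0"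
    and v: "v \<in> cone" "twist \<epsilon> \<sigma> (pl v) a b \<noteq> 0" "g v \<noteq> 0"
    and w: "w \<in> cone" "twist \<epsilon> \<sigma> (pl w) a b \<noteq> 0"
  shows "f w = 0"
proof (rule ccontr)
  assume fw: "f w \<noteq> 0"
  obtain x where x: "w = twist \<epsilon> \<sigma> (pl w) a b *s \<psi> \<epsilon> \<sigma> x" by (rule chart_point[OF w])
  obtain y where y: "v = twist \<epsilon> \<sigma> (pl v) a b *s \<psi> \<epsilon> \<sigma> y" by (rule chart_point[OF v(1,2)])
  have "f (\<psi> \<epsilon> \<sigma> x) \<noteq> 0" using fw hom_poly_scale[OF f(1)] x by (metis mult_zero_right)
  moreover have "g (\<psi> \<epsilon> \<sigma> y) \<noteq> 0" using v(3) hom_poly_scale[OF f(2)] y by (metis mult_zero_right)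
  ultimately obtain z where "f (\<psi> \<epsilon> \<sigma> (\<lambda>i. x i + z * (y i - x i))) \<noteq> 0"
      "g (\<psi> \<epsilon> \<sigma> (\<lambda>i. x i + z * (y i - x i))) \<noteq> 0"
    using line_poly_no_zero_divisors[OF line_poly_compose[OF f(1) line_poly_\<psi>] line_poly_compose[OF f(2) line_poly_\<psi>]]
    by blast
  then show False using f(3)[OF \<psi>_in_cone[of "\<lambda>i. x i + z * (y i - x i)"]] by simp
qed

end

end

section \<open>Two charts\<close>

text \<open>The chart \<open>p\<^sub>1\<^sub>5 = 1\<close> consists of the points \<open>(b, C)\<close> with \<open>b\<^sub>1 = 1\<close>. Here the linear relations alone express the rows 1 and 5 in terms of the five parameters.\<close>

definition idx\<^sub>A :: "nat \<Rightarrow> 7 \<times> 7" where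
  "idx\<^sub>A k = [(1, 3), (1, 4), (1, 6), (1, 7), (3, 5)] ! k"

definition r\<^sub>A :: "(nat \<Rightarrow> complex) \<Rightarrow> 7 \<Rightarrow> complex" where
  "r\<^sub>A t = (\<lambda>_. 0)(3 := t 0, 4 := t 1, 5 := 1, 6 := t 2, 7 := t 3)"

definition s\<^sub>A :: "(nat \<Rightarrow> complex) \<Rightarrow> 7 \<Rightarrow> complex" where
  "s\<^sub>A t = (\<lambda>_. 0)(1 := - 1, 2 := t 1, 3 := - t 4, 6 := - t 3, 7 := t 0)"

text \<open>The chart \<open>p\<^sub>1\<^sub>6 = 1\<close> also contains points where the components in \<open>A \<otimes> B\<close> are linearly dependent. The quadratic entries of its rows come from the Pluecker relations for the indices 1256, 1567 and 1267.\<close>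

definition idx\<^sub>B :: "nat \<Rightarrow> 7 \<times> 7" where
  "idx\<^sub>B k = [(1, 5), (1, 7), (2, 6), (3, 6), (6, 7)] ! k"

definition r\<^sub>B :: "(nat \<Rightarrow> complex) \<Rightarrow> 7 \<Rightarrow> complex" where
  "r\<^sub>B t = (\<lambda>_. 0)(3 := t 0 * t 4 - t 1 * t 1, 4 := - (t 0 * t 2), 5 := t 0, 6 := 1, 7 := t 1)"

definition s\<^sub>B :: "(nat \<Rightarrow> complex) \<Rightarrow> 7 \<Rightarrow> complex" where
  "s\<^sub>B t = (\<lambda>_. 0)(1 := - 1, 2 := - t 2, 3 := - t 3, 4 := - (t 1 * t 2), 5 := t 1, 7 := t 4)"

lemma all_less_5: "(\<forall>k<5. P k) \<longleftrightarrow> P 0 \<and> P (Suc 0) \<and> P 2 \<and> P 3 \<and> P (4 :: nat)"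
  by (auto simp: eval_nat_numeral less_Suc_eq)

lemma cone_relations_linear:
  assumes "cone_relations p"
  shows "p 1 2 = 0" "p 4 5 = 0" "p 1 4 = - p 2 5" "p 1 3 = p 5 7" "p 2 3 = - p 4 7"
    "p 4 6 = p 2 7" "p 5 6 = - p 1 7"
  using assms by (simp_all add: cone_relations_def omega_relations_def)

lemma antisymm_diag: "antisymm p \<Longrightarrow> p i i = 0"
proof -
  assume "antisymm p"
  then have "p i i = - p i i" unfolding antisymm_def by blast
  then show ?thesis by simp
qed

lemma antisymm_swap: "antisymm p \<Longrightarrow> p i j = - p j i"
  unfolding antisymm_def by blast

lemma chart_A: "chart 1 5 idx\<^sub>A r\<^sub>A s\<^sub>A"
proof
  fix t :: "nat \<Rightarrow> complex"
  show "omega_relations (bivec (r\<^sub>A t) (s\<^sub>A t))"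
    by (simp add: omega_relations_def bivec_def r\<^sub>A_def s\<^sub>A_def)
  show "bivec (r\<^sub>A t) (s\<^sub>A t) 1 5 = 1"
    by (simp add: bivec_def r\<^sub>A_def s\<^sub>A_def)
  have "\<forall>k<5. bivec (r\<^sub>A t) (s\<^sub>A t) (fst (idx\<^sub>A k)) (snd (idx\<^sub>A k)) = t k"
    unfolding all_less_5 by (simp add: bivec_def r\<^sub>A_def s\<^sub>A_def idx\<^sub>A_def)
  then show "bivec (r\<^sub>A t) (s\<^sub>A t) (fst (idx\<^sub>A k)) (snd (idx\<^sub>A k)) = t k" if "k < 5" for k
    using that by blast
next
  have "\<forall>i. line_poly (\<lambda>t. r\<^sub>A t i)" "\<forall>i. line_poly (\<lambda>t. s\<^sub>A t i)"
    unfolding forall_7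
    by (simp_all add: r\<^sub>A_def s\<^sub>A_def line_poly_const line_poly_coord line_poly_minus)
  then show "line_poly (\<lambda>t. r\<^sub>A t i)" "line_poly (\<lambda>t. s\<^sub>A t i)" for i by auto
next
  fix p t i assume p: "cone_relations p" "p 1 5 = 1" and t: "\<And>k. k < 5 \<Longrightarrow> t k = p (fst (idx\<^sub>A k)) (snd (idx\<^sub>A k))"
  have t': "t 0 = p 1 3" "t (Suc 0) = p 1 4" "t 2 = p 1 6" "t 3 = p 1 7" "t 4 = p 3 5"
    using t[of 0] t[of 1] t[of 2] t[of 3] t[of 4] by (simp_all add: idx\<^sub>A_def)
  have sw: "p 5 1 = - p 1 5" "p 5 2 = - p 2 5" "p 5 3 = - p 3 5" "p 5 4 = - p 4 5"
    using cone_relations_swap[OF p(1)] by blast+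
  have "p 1 1 = 0" "p 5 5 = 0" using p(1) antisymm_diag by (auto simp: cone_relations_def)
  then have "\<forall>i. p 1 i = r\<^sub>A t i \<and> p 5 i = s\<^sub>A t i"
    unfolding forall_7 using cone_relations_linear[OF p(1)] p(2) sw by (simp add: r\<^sub>A_def s\<^sub>A_def t')
  then show "p 1 i = r\<^sub>A t i \<and> p 5 i = s\<^sub>A t i" by blast
next
  fix p u :: "7 \<Rightarrow> 7 \<Rightarrow> complex" and i
  assume u: "antisymm u" "omega_relations u" "u 1 5 = 0"
    and k: "\<And>k. k < 5 \<Longrightarrow> u (fst (idx\<^sub>A k)) (snd (idx\<^sub>A k)) = 0"
  have k': "u 1 3 = 0" "u 1 4 = 0" "u 1 6 = 0" "u 1 7 = 0" "u 3 5 = 0"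
    using k[of 0] k[of 1] k[of 2] k[of 3] k[of 4] by (simp_all add: idx\<^sub>A_def)
  have sw: "u 5 1 = - u 1 5" "u 5 2 = - u 2 5" "u 5 3 = - u 3 5" "u 5 4 = - u 4 5"
    using antisymm_swap[OF u(1)] by blast+
  have "\<forall>i. u 1 i = 0 \<and> u 5 i = 0"
    unfolding forall_7 using u sw k' antisymm_diag[OF u(1)] by (simp add: omega_relations_def)
  then show "u 1 i = 0 \<and> u 5 i = 0" by blast
qed

lemma chart_B: "chart 1 6 idx\<^sub>B r\<^sub>B s\<^sub>B"
proof
  fix t :: "nat \<Rightarrow> complex"
  show "omega_relations (bivec (r\<^sub>B t) (s\<^sub>B t))"
    by (simp add: omega_relations_def bivec_def r\<^sub>B_def s\<^sub>B_def algebra_simps)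
  show "bivec (r\<^sub>B t) (s\<^sub>B t) 1 6 = 1"
    by (simp add: bivec_def r\<^sub>B_def s\<^sub>B_def)
  have "\<forall>k<5. bivec (r\<^sub>B t) (s\<^sub>B t) (fst (idx\<^sub>B k)) (snd (idx\<^sub>B k)) = t k"
    unfolding all_less_5 by (simp add: bivec_def r\<^sub>B_def s\<^sub>B_def idx\<^sub>B_def)
  then show "bivec (r\<^sub>B t) (s\<^sub>B t) (fst (idx\<^sub>B k)) (snd (idx\<^sub>B k)) = t k" if "k < 5" for k
    using that by blast
next
  have "\<forall>i. line_poly (\<lambda>t. r\<^sub>B t i)" "\<forall>i. line_poly (\<lambda>t. s\<^sub>B t i)"
    unfolding forall_7
    by (simp_all add: r\<^sub>B_def s\<^sub>B_def line_poly_const line_poly_coord line_poly_minus line_poly_mult line_poly_diff)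
  then show "line_poly (\<lambda>t. r\<^sub>B t i)" "line_poly (\<lambda>t. s\<^sub>B t i)" for i by auto
next
  fix p t i assume p: "cone_relations p" "p 1 6 = 1" and t: "\<And>k. k < 5 \<Longrightarrow> t k = p (fst (idx\<^sub>B k)) (snd (idx\<^sub>B k))"
  have t': "t 0 = p 1 5" "t (Suc 0) = p 1 7" "t 2 = p 2 6" "t 3 = p 3 6" "t 4 = p 6 7"
    using t[of 0] t[of 1] t[of 2] t[of 3] t[of 4] by (simp_all add: idx\<^sub>B_def)
  have sw: "p 6 1 = - p 1 6" "p 6 2 = - p 2 6" "p 6 3 = - p 3 6" "p 6 4 = - p 4 6" "p 6 5 = - p 5 6"
    using cone_relations_swap[OF p(1)] by blast+
  have diag: "p 1 1 = 0" "p 6 6 = 0" using p(1) antisymm_diag by (auto simp: cone_relations_def)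
  note lin = cone_relations_linear[OF p(1)]
  have "p 2 5 = p 1 5 * p 2 6" "p 5 7 = p 1 5 * p 6 7 - p 1 7 * p 1 7" "p 2 7 = p 1 7 * p 2 6"
    using cone_relations_plucker[OF p(1), of 1 2 5 6] cone_relations_plucker[OF p(1), of 1 5 6 7] cone_relations_plucker[OF p(1), of 1 2 6 7]
      lin p(2) by (simp_all add: algebra_simps add_eq_0_iff)
  then have "\<forall>i. p 1 i = r\<^sub>B t i \<and> p 6 i = s\<^sub>B t i"
    unfolding forall_7 using lin p(2) sw diag by (simp add: r\<^sub>B_def s\<^sub>B_def t')
  then show "p 1 i = r\<^sub>B t i \<and> p 6 i = s\<^sub>B t i" by blast
next
  fix p u :: "7 \<Rightarrow> 7 \<Rightarrow> complex" and i
  assume p: "cone_relations p" "p 1 6 \<noteq> 0" and u: "antisymm u" "omega_relations u" "plucker_differential p u" "u 1 6 = 0"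
    and k: "\<And>k. k < 5 \<Longrightarrow> u (fst (idx\<^sub>B k)) (snd (idx\<^sub>B k)) = 0"
  have k': "u 1 5 = 0" "u 1 7 = 0" "u 2 6 = 0" "u 3 6 = 0" "u 6 7 = 0"
    using k[of 0] k[of 1] k[of 2] k[of 3] k[of 4] by (simp_all add: idx\<^sub>B_def)
  have sw: "u 6 1 = - u 1 6" "u 6 2 = - u 2 6" "u 6 3 = - u 3 6" "u 6 4 = - u 4 6" "u 6 5 = - u 5 6"
    using antisymm_swap[OF u(1)] by blast+
  note d = u(3)[unfolded plucker_differential_def, rule_format]
  have lin: "u 1 2 = 0" "u 4 5 = 0" "u 1 4 = - u 2 5" "u 1 3 = u 5 7" "u 2 3 = - u 4 7"
    "u 4 6 = u 2 7" "u 5 6 = - u 1 7" using u(2) by (simp_all add: omega_relations_def)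
  have "u 2 5 = 0" "u 5 7 = 0" "u 2 7 = 0"
    using d[of 1 2 5 6] d[of 1 5 6 7] d[of 1 2 6 7] lin k' u(4) cone_relations_linear[OF p(1)] p(2) by simp_all
  then have "\<forall>i. u 1 i = 0 \<and> u 6 i = 0"
    unfolding forall_7 using u(4) lin sw k' antisymm_diag[OF u(1)] by simp
  then show "u 1 i = 0 \<and> u 6 i = 0" by blast
qed

lemma symmetryI:
  assumes "\<And>i. \<sigma> (\<sigma> i) = i" "\<And>i. \<epsilon> i * \<epsilon> (\<sigma> i) = 1"
    and "\<And>p. (\<And>i j. p i j = - p j i) \<Longrightarrow> omega_relations p \<Longrightarrow> omega_relations (twist \<epsilon> \<sigma> p)"
  shows "symmetry \<epsilon> \<sigma>"
  using assms unfolding symmetry_def antisymm_def by blast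

text \<open>The exchange of the two basis vectors of \<open>B\<close>, that of \<open>A\<close>, and their composition, on \<open>V = (A \<otimes> B) \<oplus> S\<^sup>2A\<^sup>*\<close>.\<close>

definition swap\<^sub>B :: "7 \<Rightarrow> 7" where "swap\<^sub>B = id(1 := 2, 2 := 1, 4 := 5, 5 := 4)"
definition sign\<^sub>B :: "7 \<Rightarrow> complex" where "sign\<^sub>B = (\<lambda>_. 1)(4 := - 1, 5 := - 1)"
definition swap\<^sub>A :: "7 \<Rightarrow> 7" where "swap\<^sub>A = id(1 := 5, 5 := 1, 2 := 4, 4 := 2, 3 := 6, 6 := 3)"
definition sign\<^sub>A :: "7 \<Rightarrow> complex" where "sign\<^sub>A = (\<lambda>_. 1)(2 := - 1, 4 := - 1, 3 := - 1, 6 := - 1)"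
definition swap\<^sub>A\<^sub>B :: "7 \<Rightarrow> 7" where "swap\<^sub>A\<^sub>B = id(1 := 4, 4 := 1, 2 := 5, 5 := 2, 3 := 6, 6 := 3)"
definition sign\<^sub>A\<^sub>B :: "7 \<Rightarrow> complex" where "sign\<^sub>A\<^sub>B = (\<lambda>_. 1)(1 := - 1, 4 := - 1, 3 := - 1, 6 := - 1)"

lemma symmetry_id: "symmetry (\<lambda>_. 1) id"
proof -
  have "twist (\<lambda>_. 1) id p = p" for p :: "7 \<Rightarrow> 7 \<Rightarrow> complex" by (simp add: twist_def fun_eq_iff)
  then show ?thesis by (simp add: symmetry_def)
qed

lemma symmetry_B: "symmetry sign\<^sub>B swap\<^sub>B"
proof (rule symmetryI)
  have "\<forall>i. swap\<^sub>B (swap\<^sub>B i) = i" "\<forall>i. sign\<^sub>B i * sign\<^sub>B (swap\<^sub>B i) = 1"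
    unfolding forall_7 by (simp_all add: swap\<^sub>B_def sign\<^sub>B_def)
  then show "swap\<^sub>B (swap\<^sub>B i) = i" "sign\<^sub>B i * sign\<^sub>B (swap\<^sub>B i) = 1" for i by blast+
  fix p :: "7 \<Rightarrow> 7 \<Rightarrow> complex" assume p: "\<And>i j. p i j = - p j i" "omega_relations p"
  have sw: "p 2 1 = - p 1 2" "p 5 4 = - p 4 5" by (rule p(1))+
  show "omega_relations (twist sign\<^sub>B swap\<^sub>B p)"
    using p(2) sw by (simp add: omega_relations_def twist_def swap\<^sub>B_def sign\<^sub>B_def)
qed

lemma symmetry_A: "symmetry sign\<^sub>A swap\<^sub>A"
proof (rule symmetryI)
  have "\<forall>i. swap\<^sub>A (swap\<^sub>A i) = i" "\<forall>i. sign\<^sub>A i * sign\<^sub>A (swap\<^sub>A i) = 1"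
    unfolding forall_7 by (simp_all add: swap\<^sub>A_def sign\<^sub>A_def)
  then show "swap\<^sub>A (swap\<^sub>A i) = i" "sign\<^sub>A i * sign\<^sub>A (swap\<^sub>A i) = 1" for i by blast+
  fix p :: "7 \<Rightarrow> 7 \<Rightarrow> complex" assume p: "\<And>i j. p i j = - p j i" "omega_relations p"
  have sw: "p 5 4 = - p 4 5" "p 2 1 = - p 1 2" "p 5 2 = - p 2 5" "p 4 1 = - p 1 4" by (rule p(1))+
  show "omega_relations (twist sign\<^sub>A swap\<^sub>A p)"
    using p(2) sw by (simp add: omega_relations_def twist_def swap\<^sub>A_def sign\<^sub>A_def)
qed

lemma symmetry_AB: "symmetry sign\<^sub>A\<^sub>B swap\<^sub>A\<^sub>B"
proof (rule symmetryI)
  have "\<forall>i. swap\<^sub>A\<^sub>B (swap\<^sub>A\<^sub>B i) = i" "\<forall>i. sign\<^sub>A\<^sub>B i * sign\<^sub>A\<^sub>B (swap\<^sub>A\<^sub>B i) = 1"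
    unfolding forall_7 by (simp_all add: swap\<^sub>A\<^sub>B_def sign\<^sub>A\<^sub>B_def)
  then show "swap\<^sub>A\<^sub>B (swap\<^sub>A\<^sub>B i) = i" "sign\<^sub>A\<^sub>B i * sign\<^sub>A\<^sub>B (swap\<^sub>A\<^sub>B i) = 1" for i by blast+
  fix p :: "7 \<Rightarrow> 7 \<Rightarrow> complex" assume p: "\<And>i j. p i j = - p j i" "omega_relations p"
  have sw: "p 4 5 = - p 5 4" "p 1 2 = - p 2 1" "p 4 1 = - p 1 4" "p 5 2 = - p 2 5" by (rule p(1))+
  show "omega_relations (twist sign\<^sub>A\<^sub>B swap\<^sub>A\<^sub>B p)"
    using p(2) sw by (simp add: omega_relations_def twist_def swap\<^sub>A\<^sub>B_def sign\<^sub>A\<^sub>B_def)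
qed

section \<open>Smoothness outside the plane\<close>

text \<open>The coordinate planes \<open>\<langle>x\<^sub>i, x\<^sub>j\<rangle>\<close> that are points of the variety outside the plane of singular points.\<close>

definition six_charts :: "(7 \<times> 7) set" where
  "six_charts = {(1, 5), (2, 4), (1, 6), (2, 6), (3, 5), (3, 4)}"

lemma chart_twists:
  "twist (\<lambda>_. 1) id p 1 5 = p 1 5" "twist sign\<^sub>B swap\<^sub>B p 1 5 = - p 2 4"
  "twist (\<lambda>_. 1) id p 1 6 = p 1 6" "twist sign\<^sub>B swap\<^sub>B p 1 6 = p 2 6"
  "twist sign\<^sub>A swap\<^sub>A p 1 6 = - p 5 3" "twist sign\<^sub>A\<^sub>B swap\<^sub>A\<^sub>B p 1 6 = p 4 3"
  by (simp_all add: twist_def sign\<^sub>A_def sign\<^sub>B_def sign\<^sub>A\<^sub>B_def swap\<^sub>A_def swap\<^sub>B_def swap\<^sub>A\<^sub>B_def)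

lemma six_charts_cases:
  assumes "(i, j) \<in> six_charts"
  obtains a b idx r s \<epsilon> \<sigma> where "chart a b idx r s" "symmetry \<epsilon> \<sigma>"
    "\<And>w. twist \<epsilon> \<sigma> (pl w) a b = 0 \<longleftrightarrow> pl w i j = 0"
proof -
  have sw: "pl w 5 3 = 0 \<longleftrightarrow> pl w 3 5 = 0" "pl w 4 3 = 0 \<longleftrightarrow> pl w 3 4 = 0" for w :: "7 ext"
    using pl_swap[of w 5 3] pl_swap[of w 4 3] by simp_all
  consider "(i, j) = (1, 5)" | "(i, j) = (2, 4)" | "(i, j) = (1, 6)" | "(i, j) = (2, 6)" | "(i, j) = (3, 5)" | "(i, j) = (3, 4)"
    using assms unfolding six_charts_def by blast
  then show ?thesis
  proof cases
    case 1 then show ?thesis using that[OF chart_A symmetry_id] by (simp add: chart_twists)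
  next
    case 2 then show ?thesis using that[OF chart_A symmetry_B] by (simp add: chart_twists)
  next
    case 3 then show ?thesis using that[OF chart_B symmetry_id] by (simp add: chart_twists)
  next
    case 4 then show ?thesis using that[OF chart_B symmetry_B] by (simp add: chart_twists)
  next
    case 5 then show ?thesis using that[OF chart_B symmetry_A] by (simp add: chart_twists sw)
  next
    case 6 then show ?thesis using that[OF chart_B symmetry_AB] by (simp add: chart_twists sw)
  qed
qed

lemma smooth_point:
  assumes w: "w \<in> cone" and ij: "(i, j) \<in> six_charts" "pl w i j \<noteq> 0"
  shows "vec.span {w} \<notin> singular_locus G2_hat"
proof -
  obtain a b idx r s \<epsilon> \<sigma> where c: "chart a b idx r s" "symmetry \<epsilon> \<sigma>"
    "\<And>w. twist \<epsilon> \<sigma> (pl w) a b = 0 \<longleftrightarrow> pl w i j = 0" by (rule six_charts_cases[OF ij(1)]) (rule that)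
  have w': "twist \<epsilon> \<sigma> (pl w) a b \<noteq> 0" using c(3) ij(2) by simp
  have "enat (vec.dim (cone_tangent_space G2_hat (vec.span {w}))) \<le> 5 + 1"
    using chart.dim_cone_tangent_space_le_6[OF c(1,2) w w'] by (simp add: numeral_eq_enat one_enat_def)
  also have "\<dots> \<le> local_dim G2_hat (vec.span {w}) + 1"
    using chart.local_dim_ge_5[OF c(1,2) w w'] by (rule add_right_mono)
  finally show ?thesis by (simp add: singular_locus_def not_less)
qed

text \<open>The subspace \<open>\<And>\<^sup>2\<langle>x\<^sub>3, x\<^sub>6, x\<^sub>7\<rangle>\<close>.\<close>

definition plane_cone :: "7 ext set" where
  "plane_cone = {w \<in> ext_power 2. \<forall>i j. pl w i j \<noteq> 0 \<longrightarrow> i \<in> {3, 6, 7} \<and> j \<in> {3, 6, 7}}"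

text \<open>When the six coordinates vanish, the linear relations identify the remaining coordinates in pairs up to sign. For each pair some Pluecker relation reduces to the vanishing of a square.\<close>

lemma outside_charts:
  assumes w: "w \<in> cone" and 0: "\<And>i j. (i, j) \<in> six_charts \<Longrightarrow> pl w i j = 0"
  shows "w \<in> plane_cone"
proof -
  let ?p = "pl w"
  have r: "cone_relations ?p" and w2: "w \<in> ext_power 2" using w by (auto simp: cone_def)
  have z: "?p 1 5 = 0" "?p 2 4 = 0" "?p 1 6 = 0" "?p 2 6 = 0" "?p 3 5 = 0" "?p 3 4 = 0"
    using 0 by (simp_all add: six_charts_def)
  note lin = cone_relations_linear[OF r]
  note sw = cone_relations_swap[OF r]
  have "?p 2 5 = 0" "?p 5 7 = 0" "?p 1 7 = 0" "?p 4 7 = 0" "?p 2 7 = 0"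
    using cone_relations_plucker[OF r, of 1 2 4 5] cone_relations_plucker[OF r, of 1 3 5 7] cone_relations_plucker[OF r, of 1 5 6 7]
      cone_relations_plucker[OF r, of 2 3 4 7] cone_relations_plucker[OF r, of 2 4 6 7] by (simp_all add: lin z)
  then have rows: "?p 1 2 = 0" "?p 1 3 = 0" "?p 1 4 = 0" "?p 1 5 = 0" "?p 1 6 = 0" "?p 1 7 = 0"
    "?p 2 3 = 0" "?p 2 4 = 0" "?p 2 5 = 0" "?p 2 6 = 0" "?p 2 7 = 0" "?p 3 4 = 0" "?p 3 5 = 0"
    "?p 4 5 = 0" "?p 4 6 = 0" "?p 4 7 = 0" "?p 5 6 = 0" "?p 5 7 = 0"
    by (simp_all add: lin z)
  have swap0: "?p j i = 0" if "?p i j = 0" for i j using that sw[of j i] by simp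
  have "\<forall>i j. ?p i j \<noteq> 0 \<longrightarrow> i \<in> {3, 6, 7} \<and> j \<in> {3, 6, 7}"
    unfolding forall_7 by (simp add: rows rows[THEN swap0] antisymm_diag[OF antisymm_pl])
  then show ?thesis using w2 by (simp add: plane_cone_def)
qed

section \<open>A dense quadratic parametrisation\<close>

text \<open>For \<open>b = (x\<^sub>1, x\<^sub>2)\<close> and the binary cubic \<open>C\<close> with coefficients \<open>c\<^sub>0, \<dots>, c\<^sub>3\<close> (the last four coordinates of \<open>x\<close>), the rows are \<open>(a\<^sub>1 \<otimes> b, C(a\<^sub>1))\<close> and \<open>(a\<^sub>2 \<otimes> b, C(a\<^sub>2))\<close>. The contractions of \<open>C\<close> are the symmetric matrices with entries \<open>c\<^sub>0, c\<^sub>1, c\<^sub>2\<close> and \<open>c\<^sub>1, c\<^sub>2, c\<^sub>3\<close>.\<close>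

definition row\<^sub>1 :: "complex ^ 6 \<Rightarrow> 7 \<Rightarrow> complex" where
  "row\<^sub>1 x = (\<lambda>_. 0)(1 := x $ 1, 2 := x $ 2, 3 := x $ 3, 6 := - x $ 5, 7 := - x $ 4)"

definition row\<^sub>2 :: "complex ^ 6 \<Rightarrow> 7 \<Rightarrow> complex" where
  "row\<^sub>2 x = (\<lambda>_. 0)(3 := x $ 4, 4 := - x $ 2, 5 := x $ 1, 6 := - x $ 6, 7 := - x $ 5)"

definition \<phi> :: "complex ^ 6 \<Rightarrow> 7 ext" where
  "\<phi> x = of_pl (bivec (row\<^sub>1 x) (row\<^sub>2 x))"

lemma antisymm_bivec: "antisymm (bivec v w)"
  unfolding antisymm_def bivec_def by simp

lemma pl_\<phi>: "pl (\<phi> x) = bivec (row\<^sub>1 x) (row\<^sub>2 x)"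
  unfolding \<phi>_def by (rule pl_of_pl[OF antisymm_bivec])

lemma \<phi>_in_cone: "\<phi> x \<in> cone"
proof -
  have "omega_relations (bivec (row\<^sub>1 x) (row\<^sub>2 x))"
    by (simp add: omega_relations_def bivec_def row\<^sub>1_def row\<^sub>2_def)
  then show ?thesis
    unfolding cone_def using pl_\<phi> cone_relations_bivec_iff of_pl_in_ext_power \<phi>_def by auto
qed

lemma hom_poly_\<phi>: "hom_poly 2 (\<lambda>x. \<phi> x $ S)"
proof -
  have neg: "hom_poly 1 (\<lambda>x :: complex ^ 6. - x $ i)" for i
    using hom_poly_cmult[OF hom_poly_coord, of "-1"] by simp
  have "\<forall>i. hom_poly 1 (\<lambda>x. row\<^sub>1 x i)" "\<forall>i. hom_poly 1 (\<lambda>x. row\<^sub>2 x i)"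
    unfolding forall_7 using neg hom_poly_coord[where ?'a = 6] hom_poly_zero[where ?'a = 6]
    by (simp_all add: row\<^sub>1_def row\<^sub>2_def)
  then have "hom_poly (1 + 1) (\<lambda>x. row\<^sub>1 x i * row\<^sub>2 x j)" for i j
    by (intro hom_poly_mult) auto
  then have "hom_poly 2 (\<lambda>x. row\<^sub>1 x i * row\<^sub>2 x j - row\<^sub>1 x j * row\<^sub>2 x i)" for i j
    by (intro hom_poly_diff) (simp_all add: numeral_2_eq_2)
  then show ?thesis
    by (cases "card S = 2") (simp_all add: \<phi>_def of_pl_def bivec_def hom_poly_zero)
qed

definition vec6 :: "complex \<Rightarrow> complex \<Rightarrow> complex \<Rightarrow> complex \<Rightarrow> complex \<Rightarrow> complex \<Rightarrow> complex ^ 6" where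
  "vec6 b b' c0 c1 c2 c3 = (\<chi> i. ((\<lambda>_. 0)(1 := b, 2 := b', 3 := c0, 4 := c1, 5 := c2, 6 := c3)) i)"

lemma vec6_nth [simp]:
  "vec6 b b' c0 c1 c2 c3 $ 1 = b" "vec6 b b' c0 c1 c2 c3 $ 2 = b'" "vec6 b b' c0 c1 c2 c3 $ 3 = c0"
  "vec6 b b' c0 c1 c2 c3 $ 4 = c1" "vec6 b b' c0 c1 c2 c3 $ 5 = c2" "vec6 b b' c0 c1 c2 c3 $ 6 = c3"
  by (simp_all add: vec6_def)

lemma cone_p15_parametrised:
  assumes "w \<in> cone" "pl w 1 5 \<noteq> 0"
  shows "\<exists>x. w = pl w 1 5 *s \<phi> x"
proof -
  obtain t where t: "w = twist (\<lambda>_. 1) id (pl w) 1 5 *s chart.\<psi> r\<^sub>A s\<^sub>A (\<lambda>_. 1) id t"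
    using chart.chart_point[OF chart_A symmetry_id assms(1)] assms(2) by (auto simp: chart_twists)
  let ?x = "vec6 1 (- t 1) (t 4) (t 0) (- t 3) (- t 2)"
  have v: "row\<^sub>2 ?x = r\<^sub>A t" "row\<^sub>1 ?x = (\<lambda>i. - s\<^sub>A t i)"
    by (simp_all add: row\<^sub>1_def row\<^sub>2_def r\<^sub>A_def s\<^sub>A_def fun_eq_iff)
  have "bivec (row\<^sub>1 ?x) (row\<^sub>2 ?x) = twist (\<lambda>_. 1) id (bivec (r\<^sub>A t) (s\<^sub>A t))"
    unfolding v by (simp add: bivec_def twist_def fun_eq_iff)
  then have "\<phi> ?x = chart.\<psi> r\<^sub>A s\<^sub>A (\<lambda>_. 1) id t"
    by (simp add: \<phi>_def chart.\<psi>_def[OF chart_A])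
  then show ?thesis using t by (intro exI[of _ ?x]) (simp add: chart_twists)
qed

section \<open>The plane\<close>

text \<open>The three expressions are the maximal minors of the Hankel matrix with rows \<open>c\<^sub>0, c\<^sub>1, c\<^sub>2\<close> and \<open>c\<^sub>1, c\<^sub>2, c\<^sub>3\<close>, that is, the coefficients of the Hessian of a binary cubic. If \<open>m1\<close> is nonzero, there are solutions with \<open>c\<^sub>0 = 0\<close> and with \<open>c\<^sub>0 = 1\<close>; reversing the coefficients settles the case that \<open>m3\<close> is nonzero, and otherwise the Hessian is that of a sum of two cubes.\<close>

lemma hankel_minors:
  fixes m1 m2 m3 :: complex
  assumes "m1 \<noteq> 0 \<or> m2 \<noteq> 0 \<or> m3 \<noteq> 0"
  shows "\<exists>c0 c1 c2 c3 d0 d1 d2 d3.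
    c0 * c2 - c1 * c1 = m1 \<and> c0 * c3 - c1 * c2 = m2 \<and> c1 * c3 - c2 * c2 = m3 \<and>
    d0 * d2 - d1 * d1 = m1 \<and> d0 * d3 - d1 * d2 = m2 \<and> d1 * d3 - d2 * d2 = m3 \<and>
    (c0 * d1 - c1 * d0 \<noteq> 0 \<or> c3 * d2 - c2 * d3 \<noteq> 0 \<or> c0 * d3 - c3 * d0 \<noteq> 0)"
proof -
  have witness: ?thesis if
    "c0 * c2 - c1 * c1 = m1 \<and> c0 * c3 - c1 * c2 = m2 \<and> c1 * c3 - c2 * c2 = m3 \<and>
     d0 * d2 - d1 * d1 = m1 \<and> d0 * d3 - d1 * d2 = m2 \<and> d1 * d3 - d2 * d2 = m3 \<and>
     (c0 * d1 - c1 * d0 \<noteq> 0 \<or> c3 * d2 - c2 * d3 \<noteq> 0 \<or> c0 * d3 - c3 * d0 \<noteq> 0)"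
    for c0 c1 c2 c3 d0 d1 d2 d3
    by (intro exI) (rule that)
  have main: "\<exists>r a b t c d. - (r * r) = m1 \<and> - (r * a) = m2 \<and> r * b - a * a = m3 \<and>
      c - t * t = m1 \<and> d - t * c = m2 \<and> t * d - c * c = m3 \<and> r \<noteq> 0" if m1: "m1 \<noteq> 0" for m1 m2 m3 :: complex
  proof -
    define r where "r = csqrt (- m1)"
    have r: "r * r = - m1" using power2_csqrt[of "- m1"] by (simp add: r_def power2_eq_square)
    then have "r \<noteq> 0" using m1 by auto
    \<comment> \<open>With \<open>c\<^sub>0 = 1\<close> and \<open>c\<^sub>1 = t\<close> the first two equations determine \<open>c\<^sub>2\<close> and \<open>c\<^sub>3\<close>, and the third becomes a quadratic equation for \<open>t\<close> with leading coefficient \<open>m1\<close> and discriminant \<open>D\<^sup>2\<close>.\<close>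
    define D where "D = csqrt (m2 * m2 - 4 * m1 * (m1 * m1 + m3))"
    have D: "D * D = m2 * m2 - 4 * m1 * (m1 * m1 + m3)"
      using power2_csqrt by (simp add: D_def power2_eq_square)
    define t where "t = (m2 + D) / (2 * m1)"
    have tD: "2 * m1 * t - m2 = D" using m1 by (simp add: t_def)
    have "4 * m1 * (m1 * t * t - m2 * t + m1 * m1 + m3) =
        (2 * m1 * t - m2) * (2 * m1 * t - m2) - (m2 * m2 - 4 * m1 * (m1 * m1 + m3))"
      by (simp add: algebra_simps)
    also have "\<dots> = 0" unfolding tD D by simp
    finally have t: "m1 * t * t - m2 * t + m1 * m1 + m3 = 0" using m1 by simp
    let ?c = "m1 + t * t"
    have "t * (m2 + t * ?c) - ?c * ?c - m3 = - (m1 * t * t - m2 * t + m1 * m1 + m3)"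
      by (simp add: algebra_simps)
    then have "t * (m2 + t * ?c) - ?c * ?c = m3" using t by simp
    then have "- (r * r) = m1 \<and> - (r * (- m2 / r)) = m2 \<and> r * ((m3 + (m2 / r) * (m2 / r)) / r) - (- m2 / r) * (- m2 / r) = m3 \<and>
      ?c - t * t = m1 \<and> (m2 + t * ?c) - t * ?c = m2 \<and> t * (m2 + t * ?c) - ?c * ?c = m3 \<and> r \<noteq> 0"
      using r \<open>r \<noteq> 0\<close> by simp
    then show ?thesis by (intro exI)
  qed
  consider "m1 \<noteq> 0" | "m3 \<noteq> 0" | "m1 = 0" "m3 = 0" "m2 \<noteq> 0" using assms by blast
  then show ?thesis
  proof cases
    case 1
    from main[OF 1, of m2 m3] obtain r a b t c d where *:
      "- (r * r) = m1" "- (r * a) = m2" "r * b - a * a = m3"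
      "c - t * t = m1" "d - t * c = m2" "t * d - c * c = m3" "r \<noteq> 0" by blast
    show ?thesis by (rule witness[of 0 a r b 1 c t d]) (use * in simp)
  next
    case 2
    from main[OF 2, of m2 m1] obtain r a b t c d where *:
      "- (r * r) = m3" "- (r * a) = m2" "r * b - a * a = m1"
      "c - t * t = m3" "d - t * c = m2" "t * d - c * c = m1" "r \<noteq> 0" by blast
    show ?thesis by (rule witness[of b r a 0 d t c 1]) (use * in \<open>simp add: mult.commute\<close>)
  next
    case 3
    then show ?thesis by (intro witness[of 1 0 0 m2 2 0 0 "m2 / 2"]) simp
  qed
qed

lemma plane_coneI:
  assumes "w \<in> ext_power 2" "\<And>i j. i \<notin> {3, 6, 7} \<Longrightarrow> pl w i j = 0"
  shows "w \<in> plane_cone"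
proof -
  have "pl w j i = 0" if "i \<notin> {3, 6, 7}" for i j using assms(2)[OF that, of j] pl_swap[of w j i] by simp
  then show ?thesis using assms unfolding plane_cone_def by blast
qed

lemma plane_cone_zero:
  assumes "w \<in> plane_cone" "i \<notin> {3, 6, 7} \<or> j \<notin> {3, 6, 7}" shows "pl w i j = 0"
  using assms unfolding plane_cone_def by blast

lemma plane_cone_eqI:
  assumes "v \<in> plane_cone" "w \<in> plane_cone"
    and "pl v 3 6 = pl w 3 6" "pl v 3 7 = pl w 3 7" "pl v 6 7 = pl w 6 7"
  shows "v = w"
proof (rule ext_power_2_eqI)
  show "v \<in> ext_power 2" "w \<in> ext_power 2" using assms by (auto simp: plane_cone_def)
  fix i j :: 7
  show "pl v i j = pl w i j"
  proof (cases "i \<in> {3, 6, 7} \<and> j \<in> {3, 6, 7}")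
    case True
    moreover have "pl v 6 3 = pl w 6 3" "pl v 7 3 = pl w 7 3" "pl v 7 6 = pl w 7 6"
      using assms(3-5) pl_swap[of v 6 3] pl_swap[of w 6 3] pl_swap[of v 7 3] pl_swap[of w 7 3]
        pl_swap[of v 7 6] pl_swap[of w 7 6] by simp_all
    moreover have "pl u i i = 0" for u :: "7 ext" and i by (rule antisymm_diag[OF antisymm_pl])
    ultimately show ?thesis using assms(3-5) by auto
  next
    case False
    then show ?thesis using plane_cone_zero assms(1,2) by metis
  qed
qed

lemma \<phi>_in_plane_cone: "\<phi> (vec6 0 0 c0 c1 c2 c3) \<in> plane_cone"
proof (rule plane_coneI)
  show "\<phi> (vec6 0 0 c0 c1 c2 c3) \<in> ext_power 2" unfolding \<phi>_def by (rule of_pl_in_ext_power)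
  show "pl (\<phi> (vec6 0 0 c0 c1 c2 c3)) i j = 0" if "i \<notin> {3, 6, 7}" for i j
    using that unfolding pl_\<phi> by (simp add: bivec_def row\<^sub>1_def row\<^sub>2_def)
qed

lemma plane_point_eq_\<phi>:
  assumes "w \<in> plane_cone"
    "c0 * c2 - c1 * c1 = - pl w 3 7" "c0 * c3 - c1 * c2 = - pl w 3 6" "c1 * c3 - c2 * c2 = - pl w 6 7"
  shows "w = \<phi> (vec6 0 0 c0 c1 c2 c3)"
proof (rule plane_cone_eqI[OF assms(1) \<phi>_in_plane_cone])
  show "pl w 3 6 = pl (\<phi> (vec6 0 0 c0 c1 c2 c3)) 3 6" "pl w 3 7 = pl (\<phi> (vec6 0 0 c0 c1 c2 c3)) 3 7"
    "pl w 6 7 = pl (\<phi> (vec6 0 0 c0 c1 c2 c3)) 6 7"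
    using assms(2-4) unfolding pl_\<phi> by (simp_all add: bivec_def row\<^sub>1_def row\<^sub>2_def algebra_simps)
qed

lemma plane_point_in_image:
  assumes "w \<in> plane_cone" shows "\<exists>x. w = \<phi> x"
proof (cases "pl w 3 7 = 0 \<and> pl w 3 6 = 0 \<and> pl w 6 7 = 0")
  case True
  then have "w = \<phi> (vec6 0 0 0 0 0 0)" by (intro plane_point_eq_\<phi>[OF assms]) auto
  then show ?thesis by blast
next
  case False
  then have "- pl w 3 7 \<noteq> 0 \<or> - pl w 3 6 \<noteq> 0 \<or> - pl w 6 7 \<noteq> 0" by simp
  from hankel_minors[OF this] plane_point_eq_\<phi>[OF assms] show ?thesis by metis
qed

lemma plane_cone_subset: "plane_cone \<subseteq> cone"
  using plane_point_in_image \<phi>_in_cone by auto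

text \<open>On the chart \<open>p\<^sub>1\<^sub>5 \<noteq> 0\<close> every point is a multiple of a value of \<open>\<phi>\<close>. Therefore \<open>f p\<^sub>1\<^sub>5\<close> vanishes on the whole cone, and the factor \<open>p\<^sub>1\<^sub>5\<close> can be cancelled on each of the other charts. The remaining points form the plane, which consists of values of \<open>\<phi>\<close>.\<close>

lemma \<phi>_dense:
  assumes f: "hom_poly d f" "\<And>x. f (\<phi> x) = 0" and w: "w \<in> cone"
  shows "f w = 0"
proof (cases "\<exists>i j. (i, j) \<in> six_charts \<and> pl w i j \<noteq> 0")
  case True
  then obtain i j where ij: "(i, j) \<in> six_charts" "pl w i j \<noteq> 0" by blast
  obtain a b idx r s \<epsilon> \<sigma> where c: "chart a b idx r s" "symmetry \<epsilon> \<sigma>"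
    "\<And>w. twist \<epsilon> \<sigma> (pl w) a b = 0 \<longleftrightarrow> pl w i j = 0" by (rule six_charts_cases[OF ij(1)]) (rule that)
  \<comment> \<open>All six chart coordinates are \<open>\<plusminus>1\<close> at this point, which is given by \<open>b = (1, 1)\<close> and a sum of two cubes.\<close>
  let ?v = "\<phi> (vec6 1 1 1 0 0 1)"
  have v: "pl ?v i j \<noteq> 0"
    using ij(1) unfolding six_charts_def pl_\<phi> by (auto simp: bivec_def row\<^sub>1_def row\<^sub>2_def)
  have v15: "pl ?v 1 5 \<noteq> 0" unfolding pl_\<phi> by (simp add: bivec_def row\<^sub>1_def row\<^sub>2_def)
  have fg: "f u * pl u 1 5 = 0" if u: "u \<in> cone" for u
  proof (cases "pl u 1 5 = 0")
    case False
    then obtain x where x: "u = pl u 1 5 *s \<phi> x" using cone_p15_parametrised[OF u] by blast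
    have "f u = pl u 1 5 ^ d * f (\<phi> x)" by (subst x) (rule hom_poly_scale[OF f(1)])
    then show ?thesis using f(2) by simp
  qed simp
  show ?thesis
    by (rule chart.chart_irreducible[OF c(1,2) f(1) hom_poly_pl fg \<phi>_in_cone _ v15 w])
      (use c(3) v ij(2) in auto)
next
  case False
  then have "w \<in> plane_cone" using outside_charts[OF w] by blast
  then show ?thesis using plane_point_in_image f(2) by auto
qed

lemma local_dim_le_5: "local_dim G2_hat L \<le> 5"
proof -
  have "local_dim G2_hat L \<le> enat (CARD(6) - 1)"
  proof (rule local_dim_le_of_parametrisation[OF hom_poly_\<phi>])
    fix d f assume f: "hom_poly d f" "\<And>x. f (\<phi> x) = 0"
    have "f w = 0" if "w \<in> cone" for w by (rule \<phi>_dense[OF f that])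
    then show "vanishes_on f G2_hat"
      using cone_scale by (auto simp: vanishes_on_def G2_hat_iff vec.span_singleton)
  qed
  then show ?thesis by (simp add: numeral_eq_enat)
qed

section \<open>Tangent vectors at the points of the plane\<close>

lemma vec_dim_range_injective:
  fixes F :: "complex ^ 'n::finite \<Rightarrow> complex ^ 'm::finite"
  assumes "Vector_Spaces.linear (*s) (*s) F" "\<And>z. F z = 0 \<Longrightarrow> z = 0"
  shows "vec.dim (range F) = CARD('n)"
proof -
  have "inj F" using assms vec.linear_inj_iff_eq_0 by blast
  then have "vec.dim (range F) = vec.dim (UNIV :: (complex ^ 'n) set)"
    using vec.dim_image_eq[OF assms(1), of UNIV] by simp
  then show ?thesis by (simp only: vec_dim_card)
qed

definition basis_bivector :: "7 \<Rightarrow> 7 \<Rightarrow> 7 ext" where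
  "basis_bivector a b = of_pl (bivec (\<lambda>i. if i = a then 1 else 0) (\<lambda>i. if i = b then 1 else 0))"

lemma pl_basis_bivector: "pl (basis_bivector a b) = bivec (\<lambda>i. if i = a then 1 else 0) (\<lambda>i. if i = b then 1 else 0)"
  unfolding basis_bivector_def by (rule pl_of_pl[OF antisymm_bivec])

lemma basis_bivector_in_plane_cone:
  assumes "a \<in> {3, 6, 7}" "b \<in> {3, 6, 7}"
  shows "basis_bivector a b \<in> plane_cone"
proof (rule plane_coneI)
  show "basis_bivector a b \<in> ext_power 2" unfolding basis_bivector_def by (rule of_pl_in_ext_power)
  show "pl (basis_bivector a b) i j = 0" if "i \<notin> {3, 6, 7}" for i j
    using that assms by (auto simp: pl_basis_bivector bivec_def)
qed

lemma subspace_plane_cone: "vec.subspace plane_cone"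
proof (rule vec.subspaceI)
  note S = subspace_ext_power[of 2]
  show "0 \<in> plane_cone" using vec.subspace_0[OF S] by (simp add: plane_cone_def pl_zero)
  show "x + y \<in> plane_cone" if "x \<in> plane_cone" "y \<in> plane_cone" for x y
  proof (rule plane_coneI)
    show "x + y \<in> ext_power 2" using that vec.subspace_add[OF S] by (auto simp: plane_cone_def)
    show "pl (x + y) i j = 0" if "i \<notin> {3, 6, 7}" for i j
      using plane_cone_zero[of _ i j] \<open>x \<in> plane_cone\<close> \<open>y \<in> plane_cone\<close> that by (simp add: pl_add)
  qed
  show "c *s x \<in> plane_cone" if "x \<in> plane_cone" for c x
  proof (rule plane_coneI)
    show "c *s x \<in> ext_power 2" using that vec.subspace_scale[OF S] by (auto simp: plane_cone_def)
    show "pl (c *s x) i j = 0" if "i \<notin> {3, 6, 7}" for i j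
      using plane_cone_zero[of _ i j] \<open>x \<in> plane_cone\<close> that by (simp add: pl_scale)
  qed
qed

lemma dim_plane_cone: "vec.dim plane_cone = 3"
proof -
  define F :: "complex ^ 3 \<Rightarrow> 7 ext" where "F z = z $ 1 *s basis_bivector 3 6 + z $ 2 *s basis_bivector 3 7 + z $ 3 *s basis_bivector 6 7" for z
  have plF: "pl (F z) 3 6 = z $ 1" "pl (F z) 3 7 = z $ 2" "pl (F z) 6 7 = z $ 3" for z
    by (simp_all add: F_def pl_add pl_scale pl_basis_bivector bivec_def)
  have "Vector_Spaces.linear (*s) (*s) F"
    unfolding Vector_Spaces.linear_iff F_def
    by (simp add: vec.vector_space_axioms vec.scale_left_distrib vec.scale_right_distrib)
  moreover have "z = 0" if "F z = 0" for z
    using plF[of z] that by (simp add: vec_eq_iff forall_3 pl_zero)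
  moreover have "range F = plane_cone"
  proof
    have inW: "F z \<in> plane_cone" for z
      unfolding F_def
      by (intro vec.subspace_add[OF subspace_plane_cone] vec.subspace_scale[OF subspace_plane_cone] basis_bivector_in_plane_cone) auto
    then show "range F \<subseteq> plane_cone" by blast
    show "plane_cone \<subseteq> range F"
    proof
      fix w assume w: "w \<in> plane_cone"
      have "w = F (vector [pl w 3 6, pl w 3 7, pl w 6 7])"
        by (rule plane_cone_eqI[OF w inW]) (simp_all add: plF)
      then show "w \<in> range F" by blast
    qed
  qed
  ultimately show ?thesis using vec_dim_range_injective[of F] by simp
qed

text \<open>The derivative of \<open>\<phi>\<close> at \<open>c\<close> in the direction \<open>b\<close>.\<close>

definition normal_vector :: "complex ^ 6 \<Rightarrow> complex ^ 6 \<Rightarrow> 7 ext" where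
  "normal_vector b c = of_pl (\<lambda>i j. bivec (row\<^sub>1 b) (row\<^sub>2 c) i j + bivec (row\<^sub>1 c) (row\<^sub>2 b) i j)"

lemma rows_line: "row\<^sub>1 (x + t *s y) i = row\<^sub>1 x i + t * row\<^sub>1 y i" "row\<^sub>2 (x + t *s y) i = row\<^sub>2 x i + t * row\<^sub>2 y i"
  by (simp_all add: row\<^sub>1_def row\<^sub>2_def)

lemma pl_normal_vector: "pl (normal_vector b c) i j = bivec (row\<^sub>1 b) (row\<^sub>2 c) i j + bivec (row\<^sub>1 c) (row\<^sub>2 b) i j"
  unfolding normal_vector_def by (subst pl_of_pl) (auto simp: antisymm_def bivec_def)

lemma cone_covered: "w \<in> cone \<Longrightarrow> \<exists>L\<in>G2_hat. w \<in> L"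
proof (cases "w = 0")
  case True
  have "\<phi> (vec6 1 0 0 0 0 0) \<noteq> 0"
  proof
    assume "\<phi> (vec6 1 0 0 0 0 0) = 0"
    then have "pl (\<phi> (vec6 1 0 0 0 0 0)) 1 5 = 0" by (simp add: pl_zero)
    then show False unfolding pl_\<phi> by (simp add: bivec_def row\<^sub>1_def row\<^sub>2_def)
  qed
  then show ?thesis using True \<phi>_in_cone vec.span_zero G2_hat_iff by blast
next
  case False
  assume "w \<in> cone"
  then show ?thesis using False G2_hat_iff vec.span_base[of w "{w}"] by blast
qed

lemma normal_vector_tangent:
  assumes "w = \<phi> c" "w \<noteq> 0"
  shows "normal_vector b c \<in> cone_tangent_space G2_hat (vec.span {w})"
proof -
  let ?\<gamma> = "\<lambda>t. \<phi> (c + t *s b)"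
  have \<gamma>0: "?\<gamma> 0 = w" using assms(1) by simp
  have deriv: "((\<lambda>t. ?\<gamma> t $ S) has_field_derivative normal_vector b c $ S) (at 0)" for S
    by (cases "card S = 2")
      (auto simp: \<phi>_def normal_vector_def of_pl_def bivec_def rows_line algebra_simps intro!: derivative_eq_intros)
  have "\<exists>L\<in>G2_hat. ?\<gamma> t \<in> L" for t by (rule cone_covered[OF \<phi>_in_cone])
  then have "normal_vector b c \<in> cone_tangent_space G2_hat (vec.span {?\<gamma> 0})"
    by (intro cone_tangent_spaceI_curve deriv) (use \<gamma>0 assms(2) in auto)
  then show ?thesis unfolding \<gamma>0 .
qed

lemma plane_vector_tangent:
  assumes "w \<in> plane_cone" "w \<noteq> 0" "u \<in> plane_cone"
  shows "u \<in> cone_tangent_space G2_hat (vec.span {w})"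
proof -
  let ?\<gamma> = "\<lambda>t. w + t *s u"
  have "?\<gamma> t \<in> plane_cone" for t
    using assms vec.subspace_add[OF subspace_plane_cone] vec.subspace_scale[OF subspace_plane_cone] by blast
  then have "\<exists>L\<in>G2_hat. ?\<gamma> t \<in> L" for t using cone_covered plane_cone_subset by blast
  then have "u \<in> cone_tangent_space G2_hat (vec.span {?\<gamma> 0})"
    by (intro cone_tangent_spaceI_curve line_coord_derivative) (use assms(2) in auto)
  then show ?thesis by simp
qed

text \<open>The three coordinate bivectors of the plane and the derivatives in two directions at two solutions \<open>c, d\<close> of \<open>\<phi> x = w\<close> are linearly independent: the coordinates of the derivatives are the products of the coefficients of \<open>b\<close> and those of the cubics, and some \<open>2 \<times> 2\<close> minor of the two cubics is nonzero.\<close>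

lemma dim_cone_tangent_space_ge_7:
  assumes w: "w \<in> plane_cone" "w \<noteq> 0"
  shows "7 \<le> vec.dim (cone_tangent_space G2_hat (vec.span {w}))"
proof -
  let ?T = "cone_tangent_space G2_hat (vec.span {w})"
  have "- pl w 3 7 \<noteq> 0 \<or> - pl w 3 6 \<noteq> 0 \<or> - pl w 6 7 \<noteq> 0"
    using plane_cone_eqI[OF w(1) vec.subspace_0[OF subspace_plane_cone]] w(2) by (auto simp: pl_zero)
  from hankel_minors[OF this] obtain c0 c1 c2 c3 d0 d1 d2 d3 where
    c: "c0 * c2 - c1 * c1 = - pl w 3 7" "c0 * c3 - c1 * c2 = - pl w 3 6" "c1 * c3 - c2 * c2 = - pl w 6 7"
    and d: "d0 * d2 - d1 * d1 = - pl w 3 7" "d0 * d3 - d1 * d2 = - pl w 3 6" "d1 * d3 - d2 * d2 = - pl w 6 7"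
    and minor: "c0 * d1 - c1 * d0 \<noteq> 0 \<or> c3 * d2 - c2 * d3 \<noteq> 0 \<or> c0 * d3 - c3 * d0 \<noteq> 0"
    by metis
  let ?c = "vec6 0 0 c0 c1 c2 c3" and ?d = "vec6 0 0 d0 d1 d2 d3"
  have wc: "w = \<phi> ?c" "w = \<phi> ?d" by (rule plane_point_eq_\<phi>[OF w(1) c] plane_point_eq_\<phi>[OF w(1) d])+
  let ?b = "vec6 1 0 0 0 0 0" and ?b' = "vec6 0 1 0 0 0 0"
  define F :: "complex ^ 7 \<Rightarrow> 7 ext" where
    "F z = z $ 1 *s basis_bivector 3 6 + z $ 2 *s basis_bivector 3 7 + z $ 3 *s basis_bivector 6 7 + z $ 4 *s normal_vector ?b ?c
       + z $ 5 *s normal_vector ?b ?d + z $ 6 *s normal_vector ?b' ?c + z $ 7 *s normal_vector ?b' ?d" for z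
  note coords = F_def pl_add pl_scale pl_basis_bivector pl_normal_vector bivec_def row\<^sub>1_def row\<^sub>2_def
  have plF:
    "pl (F z) 3 6 = z $ 1" "pl (F z) 3 7 = z $ 2" "pl (F z) 6 7 = z $ 3"
    "pl (F z) 3 5 = z $ 4 * c0 + z $ 5 * d0" "pl (F z) 1 3 = z $ 4 * c1 + z $ 5 * d1"
    "pl (F z) 1 7 = - (z $ 4 * c2 + z $ 5 * d2)" "pl (F z) 1 6 = - (z $ 4 * c3 + z $ 5 * d3)"
    "pl (F z) 3 4 = - (z $ 6 * c0 + z $ 7 * d0)" "pl (F z) 2 3 = z $ 6 * c1 + z $ 7 * d1"
    "pl (F z) 2 7 = - (z $ 6 * c2 + z $ 7 * d2)" "pl (F z) 2 6 = - (z $ 6 * c3 + z $ 7 * d3)" for z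
    by (simp_all add: coords)
  have lin: "Vector_Spaces.linear (*s) (*s) F"
    unfolding Vector_Spaces.linear_iff F_def
    by (simp add: vec.vector_space_axioms vec.scale_left_distrib vec.scale_right_distrib)
  have solve: "x = 0 \<and> y = 0" if "x * c0 + y * d0 = 0" "x * c1 + y * d1 = 0" "x * c2 + y * d2 = 0" "x * c3 + y * d3 = 0" for x y
  proof -
    have cramer: "x = 0 \<and> y = 0" if "x * p + y * q = 0" "x * p' + y * q' = 0" "p * q' - p' * q \<noteq> 0" for p q p' q'
    proof -
      have "x * (p * q' - p' * q) = (x * p + y * q) * q' - (x * p' + y * q') * q"
        "y * (p * q' - p' * q) = (x * p' + y * q') * p - (x * p + y * q) * p'"
        by (simp_all add: algebra_simps)
      then show ?thesis using that by simp
    qed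
    show ?thesis using minor cramer that by (metis mult.commute)
  qed
  have "z = 0" if "F z = 0" for z
  proof -
    have "pl (F z) i j = 0" for i j using that by (simp add: pl_zero)
    then have "z $ 1 = 0" "z $ 2 = 0" "z $ 3 = 0" "z $ 4 = 0 \<and> z $ 5 = 0" "z $ 6 = 0 \<and> z $ 7 = 0"
      using plF[of z] solve[of "z $ 4" "z $ 5"] solve[of "z $ 6" "z $ 7"] by (simp_all add: add_eq_0_iff)
    then show ?thesis by (simp add: vec_eq_iff forall_7)
  qed
  then have "vec.dim (range F) = 7" using vec_dim_range_injective[OF lin] by simp
  moreover have "range F \<subseteq> ?T"
  proof -
    note T = subspace_cone_tangent_space[of G2_hat "vec.span {w}"]
    have "F z \<in> ?T" for z
      unfolding F_def
      by (intro vec.subspace_add[OF T] vec.subspace_scale[OF T] plane_vector_tangent[OF w] basis_bivector_in_plane_cone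
          normal_vector_tangent[OF wc(1) w(2)] normal_vector_tangent[OF wc(2) w(2)]) auto
    then show ?thesis by blast
  qed
  ultimately show ?thesis using vec.dim_subset by metis
qed

lemma singular_plane_point:
  assumes "w \<in> plane_cone" "w \<noteq> 0"
  shows "vec.span {w} \<in> singular_locus G2_hat"
proof -
  have "local_dim G2_hat (vec.span {w}) + 1 \<le> 5 + 1" using local_dim_le_5 by (rule add_right_mono)
  also have "(5 :: enat) + 1 < enat 7" by (simp add: numeral_eq_enat one_enat_def)
  also have "enat 7 \<le> enat (vec.dim (cone_tangent_space G2_hat (vec.span {w})))"
    using dim_cone_tangent_space_ge_7[OF assms] by simp
  finally show ?thesis
    using assms plane_cone_subset G2_hat_iff unfolding singular_locus_def by blast
qed

section \<open>The singular locus\<close>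

theorem lemma3p11:
  shows "plane_in (ext_power 2) (singular_locus G2_hat)"
proof -
  have "L \<in> singular_locus G2_hat \<longleftrightarrow> L \<in> proj_space plane_cone" for L
  proof
    assume L: "L \<in> singular_locus G2_hat"
    then obtain w where w: "w \<in> cone" "w \<noteq> 0" "L = vec.span {w}"
      using G2_hat_iff unfolding singular_locus_def by blast
    have "w \<in> plane_cone" by (rule outside_charts[OF w(1)]) (use smooth_point[OF w(1)] L w(3) in blast)
    then show "L \<in> proj_space plane_cone"
      using w(2,3) span_singleton_in_proj_space[OF _ subspace_plane_cone] by simp
  next
    assume "L \<in> proj_space plane_cone"
    then obtain w where w: "w \<noteq> 0" "L = vec.span {w}" "L \<subseteq> plane_cone"
      unfolding proj_space_iff by blast
    then have "w \<in> plane_cone" using vec.span_base[of w "{w}"] by blast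
    then show "L \<in> singular_locus G2_hat" using singular_plane_point w(1,2) by simp
  qed
  then have "singular_locus G2_hat = proj_space plane_cone" by blast
  moreover have "plane_cone \<subseteq> ext_power 2" by (auto simp: plane_cone_def)
  ultimately show ?thesis
    unfolding plane_in_def using subspace_plane_cone dim_plane_cone by blast
qed

end
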